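(* Let $\mathbf{a}\subset\mathbb{N}^n$ be a finite exponent set connected to $\mathbf{0}$ and let $\sigma$ be a series with given coefficients $\sigma_\alpha$, $\alpha\in\mathbf{a}$. Let $\mathbf{b}=[\beta_1,\ldots,\beta_r]$, $\mathbf{c}=[\gamma_1,\ldots,\gamma_r]$, $\mathbf{p}=[p_{\beta_1},\ldots,p_{\beta_r}]$, $\mathbf{q}=[q_{\beta_1},\ldots,q_{\beta_r}]$ and $\mathbf{k}=[p_\alpha]_{\alpha\in\mathbf{d}}$ be the output of the Artinian Gorenstein border basis algorithm (described in the context) on this input. Suppose that $\mathbf{d}=\partial\mathbf{b}$ and that there is a set $\mathbf{b}'\subset\mathbb{N}^n$ connected to $\mathbf{0}$ with $\mathbf{c}^+\subset\mathbf{b}'$ and $\mathbf{x}^{\mathbf{b}^+}\cdot\mathbf{x}^{\mathbf{b}'}=\mathbf{x}^{\mathbf{a}}$. Then $\sigma$ coincides on $\langle\mathbf{x}^{\mathbf{a}}\rangle$ with a series $\tilde\sigma$ such that: (i) $\operatorname{rank}H_{\tilde\sigma}=r$; (ii) $(\mathbf{p},\mathbf{q})$ are pairwise orthogonal bases of $\mathcal{A}_{\tilde\sigma}$ for the inner product $\langle\cdot,\cdot\rangle_{\tilde\sigma}$, i.e. (the classes of) the elements of $\mathbf{p}$ and of $\mathbf{q}$ each form a basis of $\mathcal{A}_{\tilde\sigma}$, and $\langle p_{\beta_i},q_{\beta_j}\rangle_{\tilde\sigma}=1$ if $i=j$ and $0$ otherwise; (iii) the family $\mathbf{k}=\{p_\alpha:\alpha\in\partial\mathbf{b}\}$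 is a border basis of the ideal $I_{\tilde\sigma}$ with respect to $\mathbf{x}^{\mathbf{b}}$; (iv) for each $k=1,\ldots,n$, the matrix of multiplication by $x_k$ in the basis $\mathbf{p}$ (resp. $\mathbf{q}$) of $\mathcal{A}_{\tilde\sigma}$ is $M_k:=(\langle\sigma\mid x_k p_{\beta_j}q_{\beta_i}\rangle)_{1\le i,j\le r}$ (resp. its transpose $M_k^t$).
   Context: Notation. $\mathbb{K}$ is a field, $\mathbb{K}[\mathbf{x}]=\mathbb{K}[x_1,\ldots,x_n]$. A sequence $\sigma=(\sigma_\alpha)_{\alpha\in\mathbb{N}^n}\in\mathbb{K}^{\mathbb{N}^n}$ is identified with the linear form on $\mathbb{K}[\mathbf{x}]$ given by $\langle\sigma\mid\mathbf{x}^\alpha\rangle=\sigma_\alpha$ and with the corresponding formal power series ($\sum_\alpha\sigma_\alpha\mathbf{y}^\alpha/\alpha!$ in $\mathbb{K}[[\mathbf{y}]]$ in characteristic $0$); "series" means an object of this kind. $\langle p,q\rangle_\sigma:=\langle\sigma\mid pq\rangle$. The Hankel operator is $H_\sigma:\mathbb{K}[\mathbf{x}]\to\mathbb{K}[\mathbf{x}]^*$, $p\mapsto p\star\sigma$, where $\langle p\star\sigma\mid q\rangle=\langle\sigma\mid pq\rangle$; its kernel $I_\sigma$ is an ideal and $\mathcal{A}_\sigma=\mathbb{K}[\mathbf{x}]/I_\sigma$. For a set $E\subset\mathbb{N}^n$ of exponents, $\mathbf{x}^E=\{\mathbf{x}^\alpha:\alpha\in E\}$, $\mathbf{x}^E\cdot\mathbf{x}^{E'}$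 is the set of products of an element of the first by an element of the second, $\langle\cdot\rangle$ applied to a set of polynomials denotes its $\mathbb{K}$-linear span, $E^+=E\cup\bigcup_{i=1}^n(e_i+E)$ ($e_i$ the $i$-th unit vector), $\partial E=E^+\setminus E$. $E$ is connected to $\mathbf{0}$ (equivalently $\mathbf{x}^E$ is connected to $1$) if $\mathbf{0}\in E$ and every nonzero $\alpha\in E$ is $\alpha'+e_i$ for some $\alpha'\in E$ and some $i$. Border basis: a family $F\subset\mathbb{K}[\mathbf{x}]$ is a border basis, of the ideal $(F)$, with respect to a monomial set $B=\mathbf{x}^{\mathbf{b}}$ if it consists of exactly one polynomial $f_\alpha=\mathbf{x}^\alpha+b_\alpha$ with $b_\alpha\in\langle B\rangle$ for each $\alpha\in\partial\mathbf{b}$, and $\mathbb{K}[\mathbf{x}]=\langle B\rangle\oplus(F)$. Procedure $\operatorname{proj}(f,[p_1,\ldots,p_l],[m_1,\ldots,m_l])$: set $g=f$; for $i=1,\ldots,l$ successively replace $g$ by $g-\langle g,m_i\rangle_\sigma\,p_i$; return $g$. Algorithm (Artinian Gorenstein border basis). Input: the coefficients $\sigma_\alpha$, $\alpha\in\mathbf{a}$, of a series $\sigma$, where $\mathbf{a}\subset\mathbb{N}^n$ is a finite list of exponents connected to $\mathbf{0}$. Initialize $\mathbf{b}=[\,]$, $\mathbf{c}=[\,]$, $\mathbf{d}=[\,]$, $\mathbf{n}=[\mathbf{0}]$, $\mathbf{s}=\mathbf{a}$, $\mathbf{t}=\mathbf{a}$. While $\mathbf{n}\neq\emptyset$: for each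 $\alpha\in\mathbf{n}$ successively, (a) set $p_\alpha=\operatorname{proj}(\mathbf{x}^\alpha,[p_\beta]_{\beta\in\mathbf{b}},[m_\beta]_{\beta\in\mathbf{b}})$; (b) find the first $\gamma$ in the list $\mathbf{t}$ such that $\mathbf{x}^\gamma p_\alpha\in\langle\mathbf{x}^{\mathbf{a}}\rangle$ and $\langle p_\alpha,\mathbf{x}^\gamma\rangle_\sigma\neq0$; (c) if such a $\gamma$ exists, set $m_\alpha=\frac{1}{\langle p_\alpha,\mathbf{x}^\gamma\rangle_\sigma}\mathbf{x}^\gamma$ and $q_\alpha=\operatorname{proj}(m_\alpha,[q_\beta]_{\beta\in\mathbf{b}},[p_\beta]_{\beta\in\mathbf{b}})$; then add $\alpha$ to $\mathbf{b}$ and remove it from $\mathbf{s}$, add $\gamma$ to $\mathbf{c}$ and remove it from $\mathbf{t}$. Otherwise add $\alpha$ to $\mathbf{d}$ and remove it from $\mathbf{s}$. After treating all $\alpha\in\mathbf{n}$, set $\mathbf{n}=\operatorname{next}(\mathbf{b},\mathbf{d},\mathbf{c},\mathbf{s})$, the set of $\alpha\in\partial\mathbf{b}\cap\mathbf{s}$ not in $\mathbf{d}$ such that $\alpha+\gamma\in\mathbf{a}$ for all $\gamma\in\mathbf{c}$. Output: $\mathbf{b}$, $\mathbf{c}$, $\mathbf{p}=[p_\beta]_{\beta\in\mathbf{b}}$, $\mathbf{q}=[q_\beta]_{\beta\in\mathbf{b}}$, and the relations $\mathbf{k}=[p_\alpha]_{\alpha\in\mathbf{d}}$. *)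

theory Defs
  imports
    "HOL-Library.Poly_Mapping"
    "HOL-Library.Function_Algebras"
    "HOL-Algebra.Embedded_Algebras"
    "HOL-Algebra.QuotRing"
    "Jordan_Normal_Form.Matrix"
begin

section \<open>Polynomials, series and Hankel operators\<close>

text \<open>
  The variables are indexed by a finite type with n elements; Poly_Mapping supplies the commutative
  ring structure (convolution product) on polynomials. A series is the family of its coefficients,
  so that the characteristic of the field plays no role.
\<close>

type_synonym 'n expo = "'n \<Rightarrow>\<^sub>0 nat"
type_synonym ('n, 'k) mpol = "'n expo \<Rightarrow>\<^sub>0 'k"
type_synonym ('n, 'k) series = "'n expo \<Rightarrow> 'k"

definition unit_expo :: "'n \<Rightarrow> 'n expo" where
  "unit_expo i = Poly_Mapping.single i 1"

definition xpow :: "'n expo \<Rightarrow> ('n, 'k::field) mpol" where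
  "xpow \<alpha> = Poly_Mapping.single \<alpha> 1"

definition cst :: "'k \<Rightarrow> ('n, 'k::field) mpol" where
  "cst c = Poly_Mapping.single 0 c"

definition pscale :: "'k \<Rightarrow> ('n, 'k::field) mpol \<Rightarrow> ('n, 'k) mpol" where
  "pscale c p = cst c * p"

interpretation mpol: vector_space "pscale :: 'k \<Rightarrow> ('n, 'k::field) mpol \<Rightarrow> ('n, 'k) mpol"
  by unfold_locales
    (simp_all add: pscale_def cst_def algebra_simps single_add mult_single
      flip: mult.assoc)

definition fscale :: "'k \<Rightarrow> ('a \<Rightarrow> 'k::field) \<Rightarrow> 'a \<Rightarrow> 'k" where
  "fscale c \<phi> = (\<lambda>x. c * \<phi> x)"

interpretation func: vector_space "fscale :: 'k \<Rightarrow> ('a \<Rightarrow> 'k::field) \<Rightarrow> 'a \<Rightarrow> 'k"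
  by unfold_locales (simp_all add: fscale_def fun_eq_iff algebra_simps)

text \<open>The linear form on polynomials identified with a series.\<close>

definition pairing :: "('n, 'k) series \<Rightarrow> ('n, 'k::field) mpol \<Rightarrow> 'k" where
  "pairing \<sigma> p = (\<Sum>\<alpha>\<in>Poly_Mapping.keys p. \<sigma> \<alpha> * Poly_Mapping.lookup p \<alpha>)"

definition ip :: "('n, 'k) series \<Rightarrow> ('n, 'k::field) mpol \<Rightarrow> ('n, 'k) mpol \<Rightarrow> 'k" where
  "ip \<sigma> p q = pairing \<sigma> (p * q)"

definition hankel ::
  "('n, 'k) series \<Rightarrow> ('n, 'k::field) mpol \<Rightarrow> (('n, 'k) mpol \<Rightarrow> 'k)" where
  "hankel \<sigma> p = (\<lambda>q. pairing \<sigma> (p * q))"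

text \<open>The library's \<open>dim\<close> is 0 for infinite-dimensional spaces; hence the first conjunct.\<close>

definition has_rank :: "('v \<Rightarrow> ('a \<Rightarrow> 'k::field)) \<Rightarrow> nat \<Rightarrow> bool" where
  "has_rank T r \<longleftrightarrow>
     (\<exists>S. finite S \<and> func.span S = range T) \<and> func.dim (range T) = r"

definition ann :: "('n, 'k) series \<Rightarrow> ('n, 'k::field) mpol set" where
  "ann \<sigma> = {p. hankel \<sigma> p = (\<lambda>q. 0)}"

section \<open>The quotient algebra\<close>

definition poly_ring :: "('n, 'k::field) mpol ring" where
  "poly_ring = \<lparr>carrier = UNIV, monoid.mult = (*), one = 1, zero = 0, add = (+)\<rparr>"

definition quot_alg :: "('n, 'k) series \<Rightarrow> ('n, 'k::field) mpol set ring" where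
  "quot_alg \<sigma> = poly_ring Quot (ann \<sigma>)"

definition cls :: "('n, 'k) series \<Rightarrow> ('n, 'k::field) mpol \<Rightarrow> ('n, 'k) mpol set" where
  "cls \<sigma> p = ann \<sigma> +>\<^bsub>poly_ring\<^esub> p"

text \<open>The copy of the base field in the quotient algebra; in Embedded_Algebras, scalars are elements
  of the ring.\<close>

definition scalars :: "('n, 'k) series \<Rightarrow> ('n, 'k::field) mpol set set" where
  "scalars \<sigma> = range (\<lambda>c. cls \<sigma> (cst c))"

definition basis_of_quot :: "('n, 'k) series \<Rightarrow> ('n, 'k::field) mpol list \<Rightarrow> bool" where
  "basis_of_quot \<sigma> us \<longleftrightarrow>
     ring.independent (quot_alg \<sigma>) (scalars \<sigma>) (map (cls \<sigma>) us) \<and>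
     ring.Span (quot_alg \<sigma>) (scalars \<sigma>) (map (cls \<sigma>) us) = carrier (quot_alg \<sigma>)"

text \<open>Column j of the matrix holds the coordinates of the image of the j-th basis element.\<close>

definition mult_matrix ::
  "('n, 'k) series \<Rightarrow> ('n, 'k::field) mpol list \<Rightarrow> ('n, 'k) mpol \<Rightarrow> 'k mat \<Rightarrow> bool" where
  "mult_matrix \<sigma> us f M \<longleftrightarrow>
     M \<in> carrier_mat (length us) (length us) \<and>
     (\<forall>j < length us.
        cls \<sigma> f \<otimes>\<^bsub>quot_alg \<sigma>\<^esub> cls \<sigma> (us ! j) =
        ring.combine (quot_alg \<sigma>)
          (map (\<lambda>i. cls \<sigma> (cst (M $$ (i, j)))) [0..<length us]) (map (cls \<sigma>) us))"

section \<open>Exponent sets and border bases\<close>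

definition plus_set :: "'n expo set \<Rightarrow> 'n expo set" where
  "plus_set E = E \<union> (\<Union>i. (\<lambda>\<alpha>. unit_expo i + \<alpha>) ` E)"

definition border :: "'n expo set \<Rightarrow> 'n expo set" where
  "border E = plus_set E - E"

definition connected_to_0 :: "'n expo set \<Rightarrow> bool" where
  "connected_to_0 E \<longleftrightarrow>
     0 \<in> E \<and> (\<forall>\<alpha>\<in>E. \<alpha> \<noteq> 0 \<longrightarrow> (\<exists>\<alpha>'\<in>E. \<exists>i. \<alpha> = \<alpha>' + unit_expo i))"

text \<open>The polynomials \<open>f \<alpha>\<close>, for \<open>\<alpha>\<close> in the border of b, form a border basis of the ideal I.
  Values of f outside the border are irrelevant.\<close>

definition border_basis ::
  "'n expo set \<Rightarrow> ('n expo \<Rightarrow> ('n, 'k::field) mpol) \<Rightarrow> ('n, 'k) mpol set \<Rightarrow> bool" where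
  "border_basis b f I \<longleftrightarrow>
     (\<forall>\<alpha>\<in>border b. \<exists>g\<in>mpol.span (xpow ` b). f \<alpha> = xpow \<alpha> + g) \<and>
     I = Idl\<^bsub>poly_ring\<^esub> (f ` border b) \<and>
     mpol.span (xpow ` b) \<inter> I = {0} \<and>
     (\<forall>h. \<exists>u\<in>mpol.span (xpow ` b). \<exists>v\<in>I. h = u + v)"

section \<open>The algorithm\<close>

definition proj ::
  "('n, 'k) series \<Rightarrow> ('n, 'k::field) mpol \<Rightarrow> ('n, 'k) mpol list \<Rightarrow> ('n, 'k) mpol list
    \<Rightarrow> ('n, 'k) mpol" where
  "proj \<sigma> f ps ms = fold (\<lambda>(p, m) g. g - pscale (ip \<sigma> g m) p) (zip ps ms) f"

text \<open>The state holds the lists b, c, d, s, t of the algorithm and the polynomials computed so far,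
  indexed by exponents.\<close>

record (overloaded) ('n, 'k) agbb_state =
  st_b :: "'n expo list"
  st_c :: "'n expo list"
  st_d :: "'n expo list"
  st_s :: "'n expo list"
  st_t :: "'n expo list"
  st_p :: "'n expo \<Rightarrow> ('n, 'k) mpol"
  st_m :: "'n expo \<Rightarrow> ('n, 'k) mpol"
  st_q :: "'n expo \<Rightarrow> ('n, 'k) mpol"

definition agbb_init :: "'n expo list \<Rightarrow> ('n, 'k::field) agbb_state" where
  "agbb_init a = \<lparr>st_b = [], st_c = [], st_d = [], st_s = a, st_t = a,
     st_p = (\<lambda>_. 0), st_m = (\<lambda>_. 0), st_q = (\<lambda>_. 0)\<rparr>"

definition agbb_treat ::
  "'n expo list \<Rightarrow> ('n, 'k::field) series \<Rightarrow> 'n expo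
    \<Rightarrow> ('n, 'k) agbb_state \<Rightarrow> ('n, 'k) agbb_state" where
  "agbb_treat a \<sigma> \<alpha> S =
    (let p = proj \<sigma> (xpow \<alpha>) (map (st_p S) (st_b S)) (map (st_m S) (st_b S)) in
     case find (\<lambda>\<gamma>. xpow \<gamma> * p \<in> mpol.span (xpow ` set a) \<and> ip \<sigma> p (xpow \<gamma>) \<noteq> 0) (st_t S) of
       Some \<gamma> \<Rightarrow>
        (let m = pscale (1 / ip \<sigma> p (xpow \<gamma>)) (xpow \<gamma>);
             q = proj \<sigma> m (map (st_q S) (st_b S)) (map (st_p S) (st_b S))
         in S\<lparr>st_b := st_b S @ [\<alpha>], st_c := st_c S @ [\<gamma>],
              st_s := remove1 \<alpha> (st_s S), st_t := remove1 \<gamma> (st_t S),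
              st_p := (st_p S)(\<alpha> := p), st_m := (st_m S)(\<alpha> := m), st_q := (st_q S)(\<alpha> := q)\<rparr>)
     | None \<Rightarrow>
         S\<lparr>st_d := st_d S @ [\<alpha>], st_s := remove1 \<alpha> (st_s S), st_p := (st_p S)(\<alpha> := p)\<rparr>)"

definition agbb_next :: "'n expo list \<Rightarrow> ('n, 'k::field) agbb_state \<Rightarrow> 'n expo set" where
  "agbb_next a S = {\<alpha> \<in> border (set (st_b S)) \<inter> set (st_s S).
     \<alpha> \<notin> set (st_d S) \<and> (\<forall>\<gamma>\<in>set (st_c S). \<alpha> + \<gamma> \<in> set a)}"

text \<open>The order in which the elements of the set \<open>agbb_next\<close> are treated is left open, hence a
  relation between the current list n, the current state and the final state.\<close>

inductive agbb_loop ::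
  "'n expo list \<Rightarrow> ('n, 'k::field) series \<Rightarrow> 'n expo list
    \<Rightarrow> ('n, 'k) agbb_state \<Rightarrow> ('n, 'k) agbb_state \<Rightarrow> bool"
  for a :: "'n expo list" and \<sigma> :: "('n, 'k::field) series" where
  stop: "agbb_loop a \<sigma> [] S S"
| step: "n \<noteq> [] \<Longrightarrow> S' = fold (agbb_treat a \<sigma>) n S \<Longrightarrow>
    distinct n' \<Longrightarrow> set n' = agbb_next a S' \<Longrightarrow>
    agbb_loop a \<sigma> n' S' S'' \<Longrightarrow> agbb_loop a \<sigma> n S S''"

text \<open>
  The output lists of polynomials are \<open>map p b\<close>, \<open>map q b\<close> and \<open>map p d\<close>; the values of p and q at
  other exponents carry no information. The algorithm is given a total series \<open>\<sigma>\<close>: its coefficients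
  outside a can only enter through \<open>proj\<close>, and they do not when \<open>\<alpha> + \<gamma>\<close> lies in a for all
  \<open>\<alpha>\<close> in b or d and all \<open>\<gamma>\<close> in c.
\<close>

definition agbb_output ::
  "'n expo list \<Rightarrow> ('n, 'k::field) series \<Rightarrow> 'n expo list \<Rightarrow> 'n expo list \<Rightarrow> 'n expo list
    \<Rightarrow> ('n expo \<Rightarrow> ('n, 'k) mpol) \<Rightarrow> ('n expo \<Rightarrow> ('n, 'k) mpol) \<Rightarrow> bool" where
  "agbb_output a \<sigma> b c d p q \<longleftrightarrow>
     (\<exists>S. agbb_loop a \<sigma> [0] (agbb_init a) S \<and>
          b = st_b S \<and> c = st_c S \<and> d = st_d S \<and> p = st_p S \<and> q = st_q S)"

end

theory Submission
  imports Defs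
begin

text \<open>
  The algorithm is a Gram-Schmidt process in which the vectors \<open>p\<close> and their dual vectors are found
  together. When it stops, three facts hold. First, \<open>p\<close> is a
  triangular change of basis of the span \<open>V\<close> of the monomials from \<open>b\<close>, and \<open>q\<close>, taken from the span of
  the monomials from \<open>c\<close>, is dual to it for \<open>\<sigma>\<close>. Second, \<open>b\<close> is
  connected to 0; when the rejected exponents form its border, 0 is not among them. Third, a rejected
  exponent \<open>\<alpha>\<close> gives a polynomial \<open>p \<alpha>\<close>, the monomial of exponent \<open>\<alpha>\<close> plus an element of \<open>V\<close>,
  that is orthogonal to every monomial from \<open>a\<close> by which it can be multiplied within the span of the
  monomials from \<open>a\<close>: the monomials already chosen for \<open>c\<close> are covered by the projection, the others by
  the failed search for a nonzero pairing. This is \<open>agbb_output_invariant\<close>. The shape of \<open>a\<close> puts all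
  monomials from \<open>b'\<close> in this position.

  If every border exponent of \<open>b\<close> was rejected, the span of \<open>plus_set b\<close> is the direct sum of \<open>V\<close> and the
  span of the border polynomials, and the associated projection \<open>\<pi>\<close> onto \<open>V\<close> preserves pairings with
  monomials from \<open>b'\<close>. Multiplying by a variable and projecting gives operators \<open>M k\<close> on \<open>V\<close>. Pairing a product
  of two of them with the monomials from \<open>c\<close>, which separate \<open>V\<close>, shows that they commute
  (\<open>M_commute\<close>). So polynomials act on \<open>V\<close>, and letting \<open>f\<close> act on 1 defines a linear projection \<open>\<phi>\<close> onto
  \<open>V\<close> whose kernel is an ideal: a normal form.

  The extended series \<open>\<tau>\<close> is \<open>\<sigma>\<close> applied to normal forms. It agrees with \<open>\<sigma>\<close> on the given exponents by induction
  along the connected set \<open>b'\<close> (\<open>\<tau>_agrees\<close>), its annihilator is the kernel of \<open>\<phi>\<close>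
  (\<open>in_ann_iff\<close>), and this kernel is generated by the border polynomials (\<open>diff_\<phi>_in_ideal\<close>). The quotient is
  thus a copy of \<open>V\<close>, and \<open>p\<close> and \<open>q\<close> remain dual for \<open>\<tau>\<close>. A dual pair in the
  quotient gives at once two bases, the rank of the Hankel operator, and coordinates by pairing
  (\<open>dual_expansion_left\<close>, \<open>dual_expansion_right\<close>), hence the multiplication matrices.
\<close>

section \<open>Monomials and linear forms\<close>

lemma lookup_pscale [simp]:
  "Poly_Mapping.lookup (pscale c f) \<alpha> = c * Poly_Mapping.lookup f \<alpha>"
proof -
  have "pscale c f = Poly_Mapping.map ((*) c) f"
    unfolding pscale_def cst_def mult_map_scale_conv_mult ..
  then show ?thesis
    by (simp add: Poly_Mapping.map.rep_eq when_def)
qed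

lemma pscale_mult: "pscale c f * g = pscale c (f * g)" "f * pscale c g = pscale c (f * g)"
  by (simp_all add: pscale_def mult.assoc mult.left_commute)

lemma xpow_0: "xpow 0 = 1"
  by (simp add: xpow_def)

lemma xpow_mult: "xpow \<alpha> * xpow \<beta> = xpow (\<alpha> + \<beta>)"
  by (simp add: xpow_def mult_single)

lemma inj_xpow: "inj (xpow :: 'n expo \<Rightarrow> ('n, 'k::field) mpol)"
proof
  fix \<alpha> \<beta> :: "'n expo"
  assume "xpow \<alpha> = (xpow \<beta> :: ('n, 'k) mpol)"
  then have "Poly_Mapping.keys (Poly_Mapping.single \<alpha> (1::'k)) = Poly_Mapping.keys (Poly_Mapping.single \<beta> (1::'k))"
    by (simp add: xpow_def)
  then show "\<alpha> = \<beta>" by simp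
qed

lemma xpow_products:
  "{f * g | f g. f \<in> xpow ` E \<and> g \<in> xpow ` F} = xpow ` {\<alpha> + \<gamma> | \<alpha> \<gamma>. \<alpha> \<in> E \<and> \<gamma> \<in> F}"
proof (intro equalityI subsetI)
  fix h
  assume "h \<in> {f * g | f g. f \<in> xpow ` E \<and> g \<in> xpow ` F}"
  then obtain \<alpha> \<gamma> where "\<alpha> \<in> E" "\<gamma> \<in> F" "h = xpow (\<alpha> + \<gamma>)"
    by (auto simp: xpow_mult)
  then show "h \<in> xpow ` {\<alpha> + \<gamma> | \<alpha> \<gamma>. \<alpha> \<in> E \<and> \<gamma> \<in> F}" by blast
next
  fix h
  assume "h \<in> xpow ` {\<alpha> + \<gamma> | \<alpha> \<gamma>. \<alpha> \<in> E \<and> \<gamma> \<in> F}"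
  then obtain \<alpha> \<gamma> where "\<alpha> \<in> E" "\<gamma> \<in> F" "h = xpow \<alpha> * xpow \<gamma>"
    unfolding xpow_mult by blast
  then show "h \<in> {f * g | f g. f \<in> xpow ` E \<and> g \<in> xpow ` F}" by blast
qed

lemma mpol_eq_sum_xpow:
  "f = (\<Sum>\<alpha>\<in>Poly_Mapping.keys f. pscale (Poly_Mapping.lookup f \<alpha>) (xpow \<alpha>))"
proof (rule poly_mapping_eqI)
  fix \<beta>
  let ?g = "\<lambda>\<alpha>. pscale (Poly_Mapping.lookup f \<alpha>) (xpow \<alpha>)"
  have "Poly_Mapping.lookup (\<Sum>\<alpha>\<in>Poly_Mapping.keys f. ?g \<alpha>) \<beta>
      = (\<Sum>\<alpha>\<in>Poly_Mapping.keys f. if \<alpha> = \<beta> then Poly_Mapping.lookup f \<alpha> else 0)"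
    unfolding lookup_sum by (rule sum.cong) (auto simp: xpow_def lookup_single when_def)
  then show "Poly_Mapping.lookup f \<beta> = Poly_Mapping.lookup (\<Sum>\<alpha>\<in>Poly_Mapping.keys f. ?g \<alpha>) \<beta>"
    by (simp add: in_keys_iff)
qed

lemma span_xpow:
  fixes E :: "'n expo set"
  shows "mpol.span (xpow ` E :: ('n, 'k::field) mpol set) = {f. Poly_Mapping.keys f \<subseteq> E}"
proof (intro equalityI subsetI)
  fix f :: "('n, 'k) mpol"
  assume "f \<in> mpol.span (xpow ` E)"
  then show "f \<in> {f. Poly_Mapping.keys f \<subseteq> E}"
  proof (induction rule: mpol.span_induct_alt)
    case (step c x y)
    have "Poly_Mapping.keys (pscale c x) \<subseteq> E"
      using step(1) by (auto simp: in_keys_iff xpow_def lookup_single when_def split: if_splits)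
    then show ?case
      using step(2) keys_add[of "pscale c x" y] by auto
  qed simp
next
  fix f :: "('n, 'k) mpol"
  assume "f \<in> {f. Poly_Mapping.keys f \<subseteq> E}"
  then show "f \<in> mpol.span (xpow ` E)"
    by (subst mpol_eq_sum_xpow)
      (rule mpol.span_sum, rule mpol.span_scale, rule mpol.span_base, auto)
qed

lemma span_xpow_UNIV: "mpol.span (range xpow) = UNIV"
  by (simp add: span_xpow)

lemma independent_xpow: "mpol.independent (range xpow)"
proof
  assume "mpol.dependent (range (xpow :: 'n expo \<Rightarrow> ('n, 'k::field) mpol))"
  then obtain \<alpha> :: "'n expo" where "(xpow \<alpha> :: ('n, 'k) mpol) \<in> mpol.span (range xpow - {xpow \<alpha>})"
    unfolding mpol.dependent_def by auto
  also have "range xpow - {xpow \<alpha> :: ('n, 'k) mpol} = xpow ` (UNIV - {\<alpha>})"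
    using inj_xpow by (auto dest: injD)
  finally show False
    unfolding span_xpow by (simp add: xpow_def)
qed

text \<open>
  Multiplication by a monomial only shifts exponents. This is the bookkeeping that tells which pairings
  involve known coefficients of the series.
\<close>

lemma xpow_mult_span:
  assumes "f \<in> mpol.span (xpow ` E)"
  shows "xpow \<gamma> * f \<in> mpol.span (xpow ` ((+) \<gamma> ` E))"
proof -
  have "Poly_Mapping.keys (xpow \<gamma> * f) \<subseteq> (+) \<gamma> ` E"
    using keys_mult[of "xpow \<gamma>" f] assms unfolding span_xpow
    by (auto simp: xpow_def split: if_splits)
  then show ?thesis unfolding span_xpow by simp
qed

interpretation mpol_pair: vector_space_pair
  "pscale :: 'k \<Rightarrow> ('n, 'k::field) mpol \<Rightarrow> ('n, 'k) mpol"
  "pscale :: 'k \<Rightarrow> ('m, 'k) mpol \<Rightarrow> ('m, 'k) mpol" ..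

lemma pairing_eq_sum:
  assumes "finite A" "Poly_Mapping.keys f \<subseteq> A"
  shows "pairing \<sigma> f = (\<Sum>\<alpha>\<in>A. \<sigma> \<alpha> * Poly_Mapping.lookup f \<alpha>)"
  unfolding pairing_def using assms
  by (intro sum.mono_neutral_left) (auto simp: in_keys_iff)

lemma pairing_add: "pairing \<sigma> (f + g) = pairing \<sigma> f + pairing \<sigma> g"
  using keys_add[of f g]
  by (simp add: pairing_eq_sum[of "Poly_Mapping.keys f \<union> Poly_Mapping.keys g"] lookup_add
      sum.distrib algebra_simps)

lemma pairing_pscale: "pairing \<sigma> (pscale c f) = c * pairing \<sigma> f"
proof -
  have "Poly_Mapping.keys (pscale c f) \<subseteq> Poly_Mapping.keys f"
    by (auto simp: in_keys_iff)
  then show ?thesis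
    by (simp add: pairing_eq_sum[of "Poly_Mapping.keys f"] sum_distrib_left mult_ac)
qed

lemma pairing_0 [simp]: "pairing \<sigma> 0 = 0"
  by (simp add: pairing_def)

lemma pairing_diff: "pairing \<sigma> (f - g) = pairing \<sigma> f - pairing \<sigma> g"
  using pairing_add[of \<sigma> "f - g" g] by simp

lemma pairing_sum: "pairing \<sigma> (\<Sum>i\<in>I. f i) = (\<Sum>i\<in>I. pairing \<sigma> (f i))"
  by (induction I rule: infinite_finite_induct) (simp_all add: pairing_add)

lemma pairing_xpow: "pairing \<sigma> (xpow \<alpha>) = \<sigma> \<alpha>"
  by (simp add: pairing_def xpow_def)

lemma ip_commute: "ip \<sigma> f g = ip \<sigma> g f"
  by (simp add: ip_def mult.commute)

lemma ip_0_left [simp]: "ip \<sigma> 0 g = 0"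
  by (simp add: ip_def)

lemma ip_add_left: "ip \<sigma> (f + g) h = ip \<sigma> f h + ip \<sigma> g h"
  by (simp add: ip_def pairing_add ring_distribs)

lemma ip_diff_left: "ip \<sigma> (f - g) h = ip \<sigma> f h - ip \<sigma> g h"
  by (simp add: ip_def pairing_diff ring_distribs left_diff_distrib)

lemma ip_pscale_left: "ip \<sigma> (pscale c f) h = c * ip \<sigma> f h"
  by (simp add: ip_def pairing_pscale pscale_mult)

lemma ip_sum_left: "ip \<sigma> (\<Sum>i\<in>I. f i) h = (\<Sum>i\<in>I. ip \<sigma> (f i) h)"
  by (simp add: ip_def pairing_sum sum_distrib_right)

lemma ip_mult_left: "ip \<sigma> (g * f) h = ip \<sigma> f (g * h)"
  by (simp add: ip_def mult.left_commute mult.commute mult.assoc)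

lemma ip_span_right_eq_0:
  assumes "\<And>g. g \<in> G \<Longrightarrow> ip \<sigma> f g = 0" and "h \<in> mpol.span G"
  shows "ip \<sigma> f h = 0"
proof -
  have G: "ip \<sigma> g f = 0" if "g \<in> G" for g
    using assms(1)[OF that] by (simp add: ip_commute)
  have "ip \<sigma> h f = 0"
    using assms(2) by (induction rule: mpol.span_induct_alt)
      (simp_all add: G ip_add_left ip_pscale_left)
  then show ?thesis by (simp add: ip_commute)
qed

lemma linear_mult: "Vector_Spaces.linear pscale pscale ((*) g)"
  by unfold_locales (simp_all add: ring_distribs pscale_mult)

section \<open>Exponent sets and commuting operators\<close>

lemma subset_plus_set: "E \<subseteq> plus_set E"
  by (simp add: plus_set_def)

lemma unit_expo_plus_set: "\<alpha> \<in> E \<Longrightarrow> unit_expo i + \<alpha> \<in> plus_set E"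
  by (auto simp: plus_set_def)

lemma zero_notin_border:
  fixes E :: "'n expo set"
  shows "0 \<notin> border E"
proof
  assume "0 \<in> border E"
  then obtain i and \<alpha> :: "'n expo" where "0 = unit_expo i + \<alpha>"
    by (force simp: border_def plus_set_def)
  then have "Poly_Mapping.lookup (unit_expo i + \<alpha>) i = 0" by (metis lookup_zero)
  then show False by (simp add: unit_expo_def lookup_add)
qed

lemma plus_set_mono: "E \<subseteq> F \<Longrightarrow> plus_set E \<subseteq> plus_set F"
  by (auto simp: plus_set_def)

text \<open>
  A set connected to 0 admits induction along paths of unit steps inside the set, because the total
  degree drops at each step back. With the set of all exponents it is the usual induction on monomials.
\<close>

lemma connected_induct [consumes 2, case_names zero step]:
  fixes \<alpha> :: "('n::finite) expo"
  assumes "connected_to_0 E" and "\<alpha> \<in> E"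
    and "P 0"
    and "\<And>\<beta> i. \<beta> \<in> E \<Longrightarrow> P \<beta> \<Longrightarrow> unit_expo i + \<beta> \<in> E \<Longrightarrow> P (unit_expo i + \<beta>)"
  shows "P \<alpha>"
  using assms(2)
proof (induction "\<Sum>i\<in>UNIV. Poly_Mapping.lookup \<alpha> i" arbitrary: \<alpha> rule: less_induct)
  case less
  show ?case
  proof (cases "\<alpha> = 0")
    case False
    then obtain \<beta> i where \<beta>: "\<beta> \<in> E" "\<alpha> = \<beta> + unit_expo i"
      using assms(1) less.prems unfolding connected_to_0_def by blast
    have "(\<Sum>j\<in>UNIV. Poly_Mapping.lookup \<beta> j) < (\<Sum>j\<in>UNIV. Poly_Mapping.lookup \<alpha> j)"
      by (rule sum_strict_mono_ex1) (auto simp: \<beta> unit_expo_def lookup_add intro!: exI[of _ i])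
    then show ?thesis
      using assms(4) less \<beta> by (simp add: add.commute)
  qed (use assms(3) in simp)
qed

lemma connected_UNIV: "connected_to_0 (UNIV :: 'n expo set)"
  unfolding connected_to_0_def
proof (intro conjI ballI impI)
  fix \<alpha> :: "'n expo"
  assume "\<alpha> \<noteq> 0"
  then obtain i where i: "Poly_Mapping.lookup \<alpha> i \<noteq> 0"
    by (metis poly_mapping_eqI lookup_zero)
  have "\<alpha> = (\<alpha> - unit_expo i) + unit_expo i"
    by (rule poly_mapping_eqI)
      (use i in \<open>auto simp: lookup_add lookup_minus unit_expo_def lookup_single when_def\<close>)
  then show "\<exists>\<alpha>'\<in>UNIV. \<exists>i. \<alpha> = \<alpha>' + unit_expo i" by blast
qed simp

lemma funpow_commute_on:
  assumes "\<And>v. v \<in> V \<Longrightarrow> S v \<in> V" and "\<And>v. v \<in> V \<Longrightarrow> T v \<in> V"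
    and "\<And>v. v \<in> V \<Longrightarrow> S (T v) = T (S v)" and "v \<in> V"
  shows "(S ^^ n) v \<in> V \<and> (S ^^ n) (T v) = T ((S ^^ n) v)"
  using assms(4) by (induction n) (simp_all add: assms(1-3))

text \<open>
  Commuting operators \<open>M k\<close> let the monomials act on a vector: \<open>g \<alpha>\<close> is the value at \<open>v0\<close> of the
  product of the powers \<open>M k ^^ \<alpha> k\<close>. The product is taken along a list of all variables, and commutation
  is what allows one more factor \<open>M k\<close> to be pulled out to the front. Commutation is asked only on an
  invariant set \<open>V\<close>, since the operators used below commute on a subspace.
\<close>

lemma commuting_orbit:
  fixes M :: "('n::finite) \<Rightarrow> 'a \<Rightarrow> 'a"
  assumes "v0 \<in> V"
    and M: "\<And>k v. v \<in> V \<Longrightarrow> M k v \<in> V"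
    and comm: "\<And>j k v. v \<in> V \<Longrightarrow> M j (M k v) = M k (M j v)"
  obtains g :: "'n expo \<Rightarrow> 'a" where "g 0 = v0" "\<And>\<alpha>. g \<alpha> \<in> V"
    "\<And>k \<alpha>. g (unit_expo k + \<alpha>) = M k (g \<alpha>)"
proof -
  let ?F = "\<lambda>ks (\<alpha> :: 'n expo). foldr (\<lambda>k. M k ^^ Poly_Mapping.lookup \<alpha> k) ks v0"
  have pow: "(M j ^^ n) v \<in> V \<and> (M j ^^ n) (M k v) = M k ((M j ^^ n) v)" if "v \<in> V" for j k n v
    using that M comm by (intro funpow_commute_on)
  have V: "?F ks \<alpha> \<in> V" for ks \<alpha>
    by (induction ks) (auto simp: assms(1) pow)
  have notin: "?F ks (unit_expo k + \<alpha>) = ?F ks \<alpha>" if "k \<notin> set ks" for ks k \<alpha>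
    using that by (induction ks) (auto simp: unit_expo_def lookup_add lookup_single when_def)
  have step: "?F ks (unit_expo k + \<alpha>) = M k (?F ks \<alpha>)" if "distinct ks" "k \<in> set ks" for ks k \<alpha>
    using that
  proof (induction ks)
    case (Cons j ks)
    show ?case
    proof (cases "k = j")
      case True
      then show ?thesis
        using Cons.prems notin[of k ks \<alpha>] by (simp add: unit_expo_def lookup_add)
    next
      case False
      then show ?thesis
        using Cons pow[OF V] by (simp add: unit_expo_def lookup_add lookup_single)
    qed
  qed simp
  obtain ks :: "'n list" where ks: "set ks = UNIV" "distinct ks"
    using finite_distinct_list[of "UNIV :: 'n set"] by auto
  have zero: "?F ks 0 = v0" for ks by (induction ks) auto
  show thesis
    by (rule that[of "?F ks"]) (rule zero V step[OF ks(2)] | simp add: ks(1))+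
qed

section \<open>The quotient by the kernel of a Hankel operator\<close>

lemma cring_poly_ring: "cring (poly_ring :: ('n, 'k::field) mpol ring)"
proof (rule cringI)
  show "abelian_group (poly_ring :: ('n, 'k) mpol ring)"
    by (rule abelian_groupI) (auto simp: poly_ring_def algebra_simps intro: exI[of _ "- x" for x])
  show "Group.comm_monoid (poly_ring :: ('n, 'k) mpol ring)"
    by (rule comm_monoidI) (auto simp: poly_ring_def algebra_simps)
qed (simp add: poly_ring_def algebra_simps)

lemma a_inv_poly_ring: "\<ominus>\<^bsub>poly_ring\<^esub> (f :: ('n, 'k::field) mpol) = - f"
proof -
  interpret cring "poly_ring :: ('n, 'k) mpol ring" by (rule cring_poly_ring)
  show ?thesis by (rule minus_equality) (simp_all add: poly_ring_def)
qed

lemma ideal_poly_ringI: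
  fixes J :: "('n, 'k::field) mpol set"
  assumes "0 \<in> J" and "\<And>f g. f \<in> J \<Longrightarrow> g \<in> J \<Longrightarrow> f + g \<in> J"
    and mult: "\<And>f g. f \<in> J \<Longrightarrow> g * f \<in> J"
  shows "ideal J poly_ring"
proof -
  interpret cring "poly_ring :: ('n, 'k) mpol ring" by (rule cring_poly_ring)
  have "subgroup J (add_monoid poly_ring)"
  proof (rule add.subgroupI)
    fix f assume "f \<in> J"
    then show "\<ominus>\<^bsub>poly_ring\<^esub> f \<in> J"
      using mult[of f "- 1"] by (simp add: a_inv_poly_ring)
  qed (use assms in \<open>auto simp: poly_ring_def\<close>)
  then show ?thesis
    using mult by (intro idealI ring_axioms) (auto simp: poly_ring_def mult.commute)
qed

lemma in_ann: "f \<in> ann \<tau> \<longleftrightarrow> (\<forall>g. ip \<tau> f g = 0)"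
  by (simp add: ann_def hankel_def ip_def fun_eq_iff)

lemma ideal_ann: "ideal (ann \<tau>) poly_ring"
  by (rule ideal_poly_ringI) (auto simp: in_ann ip_add_left ip_mult_left)

context
  fixes \<tau> :: "('n, 'k::field) series"
begin

interpretation I: ideal "ann \<tau>" poly_ring
  by (rule ideal_ann)

interpretation Q: ring "quot_alg \<tau>"
  unfolding quot_alg_def by (rule I.quotient_is_ring)

lemma carrier_quot_alg: "carrier (quot_alg \<tau>) = range (cls \<tau>)"
  by (auto simp: quot_alg_def FactRing_def A_RCOSETS_def' cls_def poly_ring_def)

lemma cls_in_carrier [simp]: "cls \<tau> f \<in> carrier (quot_alg \<tau>)"
  by (simp add: carrier_quot_alg)

lemma cls_conv: "cls \<tau> f = {h. h - f \<in> ann \<tau>}"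
  by (force simp: cls_def a_r_coset_def' poly_ring_def)

lemma cls_eq_iff: "cls \<tau> f = cls \<tau> g \<longleftrightarrow> f - g \<in> ann \<tau>"
proof
  assume "cls \<tau> f = cls \<tau> g"
  moreover have "f \<in> cls \<tau> f" by (simp add: cls_conv in_ann)
  ultimately show "f - g \<in> ann \<tau>" by (simp add: cls_conv)
qed (auto simp: cls_conv in_ann ip_diff_left)

lemma cls_mult: "cls \<tau> f \<otimes>\<^bsub>quot_alg \<tau>\<^esub> cls \<tau> g = cls \<tau> (f * g)"
  using I.rcoset_mult_add[of f g] by (simp add: cls_def quot_alg_def FactRing_def poly_ring_def)

lemma cls_add: "cls \<tau> f \<oplus>\<^bsub>quot_alg \<tau>\<^esub> cls \<tau> g = cls \<tau> (f + g)"
  using I.a_rcos_sum[of f g] by (simp add: cls_def quot_alg_def FactRing_def poly_ring_def)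

lemma cls_zero: "\<zero>\<^bsub>quot_alg \<tau>\<^esub> = cls \<tau> 0"
  by (simp add: cls_conv quot_alg_def FactRing_def)

lemma combine_cls:
  "ring.combine (quot_alg \<tau>) (map (\<lambda>i. cls \<tau> (cst (k i))) [0..<length us]) (map (cls \<tau>) us)
    = cls \<tau> (\<Sum>i<length us. pscale (k i) (us ! i))"
proof (induction us arbitrary: k)
  case Nil
  then show ?case by (simp add: cls_zero)
next
  case (Cons u us)
  have "map (\<lambda>i. cls \<tau> (cst (k i))) [0..<length (u # us)]
      = cls \<tau> (cst (k 0)) # map (\<lambda>i. cls \<tau> (cst (k (Suc i)))) [0..<length us]"
    by (simp add: upt_conv_Cons map_Suc_upt[symmetric] del: upt_Suc)
  then show ?case
    by (simp add: Cons.IH cls_mult cls_add sum.lessThan_Suc_shift pscale_def del: sum.lessThan_Suc)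
qed

text \<open>
  The locale-based span of classes, with scalars the classes of constants, is the image of an ordinary
  linear span. The facts about bases of the quotient thereby reduce to linear algebra among polynomials,
  modulo the annihilator.
\<close>

lemma Span_cls:
  "ring.Span (quot_alg \<tau>) (scalars \<tau>) (map (cls \<tau>) us) = cls \<tau> ` mpol.span (set us)"
proof (induction us)
  case Nil
  then show ?case by (simp add: cls_zero)
next
  case (Cons u us)
  have "ring.Span (quot_alg \<tau>) (scalars \<tau>) (map (cls \<tau>) (u # us))
      = (scalars \<tau> #>\<^bsub>quot_alg \<tau>\<^esub> cls \<tau> u) <+>\<^bsub>quot_alg \<tau>\<^esub> cls \<tau> ` mpol.span (set us)"
    using Cons.IH by (simp add: Q.line_extension_def)
  also have "\<dots> = {cls \<tau> (pscale c u + f) | c f. f \<in> mpol.span (set us)}"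
    by (auto simp: set_add_def' r_coset_def scalars_def cls_mult cls_add pscale_def)
  also have "\<dots> = cls \<tau> ` mpol.span (set (u # us))"
    by (auto simp: mpol.span_insert image_iff) (metis add.commute add_diff_cancel_left' diff_add_cancel)+
  finally show ?case .
qed

text \<open>
  A family with a dual family is independent: were one class a combination of the later ones, pairing
  with its dual vector would give 1 on one side and 0 on the other.
\<close>

lemma independent_cls:
  assumes "length vs = length us"
    and dual: "\<And>i j. i < length us \<Longrightarrow> j < length us \<Longrightarrow>
      ip \<tau> (us ! i) (vs ! j) = (if i = j then 1 else 0)"
  shows "ring.independent (quot_alg \<tau>) (scalars \<tau>) (map (cls \<tau>) us)"
  using assms
proof (induction us arbitrary: vs)
  case (Cons u us)
  then obtain v vs' where vs: "vs = v # vs'" by (cases vs) auto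
  have "cls \<tau> u \<notin> cls \<tau> ` mpol.span (set us)"
  proof
    assume "cls \<tau> u \<in> cls \<tau> ` mpol.span (set us)"
    then obtain f where f: "f \<in> mpol.span (set us)" "u - f \<in> ann \<tau>"
      by (auto simp: cls_eq_iff)
    have "ip \<tau> v f = 0"
    proof (rule ip_span_right_eq_0[OF _ f(1)])
      fix g assume "g \<in> set us"
      then obtain i where "i < length us" "g = us ! i" by (auto simp: in_set_conv_nth)
      then show "ip \<tau> v g = 0"
        using Cons.prems(2)[of "Suc i" 0] by (simp add: vs ip_commute)
    qed
    moreover have "ip \<tau> v u = 1"
      using Cons.prems(2)[of 0 0] by (simp add: vs ip_commute)
    moreover have "ip \<tau> (u - f) v = 0"
      using f(2) by (simp add: in_ann)
    ultimately show False
      unfolding ip_diff_left by (simp add: ip_commute)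
  qed
  moreover have "ring.independent (quot_alg \<tau>) (scalars \<tau>) (map (cls \<tau>) us)"
    using Cons.prems(1) Cons.prems(2)[of "Suc _" "Suc _"] by (intro Cons.IH[of vs']) (auto simp: vs)
  ultimately show ?case
    unfolding list.map(2) by (intro Q.li_Cons) (simp_all only: Span_cls cls_in_carrier not_False_eq_True)
qed simp

lemma basis_of_quotI:
  assumes "length vs = length us"
    and "\<And>i j. i < length us \<Longrightarrow> j < length us \<Longrightarrow>
      ip \<tau> (us ! i) (vs ! j) = (if i = j then 1 else 0)"
    and span: "\<And>f. \<exists>u\<in>mpol.span (set us). f - u \<in> ann \<tau>"
  shows "basis_of_quot \<tau> us"
  unfolding basis_of_quot_def Span_cls carrier_quot_alg
  using independent_cls[OF assms(1,2)] span by (auto simp: image_iff cls_eq_iff)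

lemma mult_matrixI:
  assumes "A \<in> carrier_mat (length us) (length us)"
    and "\<And>j. j < length us \<Longrightarrow>
      f * us ! j - (\<Sum>i<length us. pscale (A $$ (i, j)) (us ! i)) \<in> ann \<tau>"
  shows "mult_matrix \<tau> us f A"
  using assms unfolding mult_matrix_def by (simp add: combine_cls cls_mult cls_eq_iff)

end

lemma hankel_add: "hankel \<tau> (f + g) = hankel \<tau> f + hankel \<tau> g"
  by (simp add: hankel_def fun_eq_iff ring_distribs pairing_add)

lemma hankel_pscale: "hankel \<tau> (pscale c f) = fscale c (hankel \<tau> f)"
  by (simp add: hankel_def fscale_def pscale_mult pairing_pscale)

lemma sum_apply: "(\<Sum>i\<in>I. f i) x = (\<Sum>i\<in>I. f i x)"
  by (induction I rule: infinite_finite_induct) simp_all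

text \<open>
  The Hankel operator factors through the quotient, so the images of the generators \<open>us\<close> span its range;
  evaluation at the dual vectors \<open>vs\<close> shows that these images are independent.
\<close>

lemma has_rank_hankelI:
  assumes "length vs = length us"
    and dual: "\<And>i j. i < length us \<Longrightarrow> j < length us \<Longrightarrow>
      ip \<tau> (us ! i) (vs ! j) = (if i = j then 1 else 0)"
    and span: "\<And>f. \<exists>u\<in>mpol.span (set us). f - u \<in> ann \<tau>"
  shows "has_rank (hankel \<tau>) (length us)"
proof -
  let ?h = "\<lambda>i. hankel \<tau> (us ! i)"
  have ev: "?h i (vs ! j) = (if i = j then 1 else 0)" if "i < length us" "j < length us" for i j
    using dual[OF that] by (simp add: hankel_def ip_def)
  have inj: "inj_on ?h {..<length us}"
    using ev by (intro inj_onI) (metis lessThan_iff zero_neq_one)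
  have indep: "func.independent (?h ` {..<length us})"
    unfolding func.dependent_finite[OF finite_imageI[OF finite_lessThan]]
  proof (rule notI, elim exE conjE bexE)
    fix u v
    assume 0: "(\<Sum>v\<in>?h ` {..<length us}. fscale (u v) v) = 0"
      and "v \<in> ?h ` {..<length us}" "u v \<noteq> 0"
    then obtain j where j: "j < length us" "u (?h j) \<noteq> 0" by blast
    have "0 = (\<Sum>i<length us. fscale (u (?h i)) (?h i)) (vs ! j)"
      using 0 by (simp add: sum.reindex[OF inj])
    also have "\<dots> = (\<Sum>i<length us. if i = j then u (?h j) else 0)"
      unfolding sum_apply by (rule sum.cong) (use j in \<open>auto simp: fscale_def ev\<close>)
    finally show False using j by simp
  qed
  have "hankel \<tau> f \<in> func.span (?h ` {..<length us})" for f
  proof -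
    obtain u where u: "u \<in> mpol.span (set us)" "f - u \<in> ann \<tau>" using span by blast
    have "hankel \<tau> f = hankel \<tau> u"
      using u(2) hankel_add[of \<tau> "f - u" u] by (simp add: ann_def fun_eq_iff)
    also have "hankel \<tau> u \<in> func.span (?h ` {..<length us})"
      using u(1)
    proof (induction rule: mpol.span_induct_alt)
      case base
      show ?case using func.span_zero by (simp add: hankel_def zero_fun_def)
    next
      case (step c g h)
      then have "hankel \<tau> g \<in> func.span (?h ` {..<length us})"
        by (auto simp: in_set_conv_nth intro: func.span_base)
      then show ?case
        using step(2) unfolding hankel_add hankel_pscale
        by (intro func.span_add func.span_scale)
    qed
    finally show ?thesis .
  qed
  moreover have "func.span (?h ` {..<length us}) \<subseteq> range (hankel \<tau>)"
  proof
    fix \<phi> assume "\<phi> \<in> func.span (?h ` {..<length us})"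
    then show "\<phi> \<in> range (hankel \<tau>)"
    proof (induction rule: func.span_induct_alt)
      case base
      show ?case by (rule image_eqI[of _ _ 0]) (simp_all add: hankel_def zero_fun_def)
    next
      case (step c x y)
      then obtain f g where "x = hankel \<tau> f" "y = hankel \<tau> g" by auto
      then show ?case by (simp flip: hankel_add hankel_pscale)
    qed
  qed
  ultimately have range: "func.span (?h ` {..<length us}) = range (hankel \<tau>)" by blast
  have "func.dim (range (hankel \<tau>)) = card (?h ` {..<length us})"
    by (rule func.dim_eq_card[OF _ indep])
      (simp add: range[symmetric] func.span_span)
  also have "\<dots> = length us" by (simp add: card_image[OF inj])
  finally show ?thesis
    unfolding has_rank_def using range by blast
qed

text \<open>
  Expansion in a dual pair. After subtraction of its expansion along \<open>vs\<close>, a polynomial is orthogonal to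
  every element of \<open>us\<close>; as \<open>us\<close> generates everything modulo the annihilator, what is left lies in the
  annihilator. In particular \<open>vs\<close> generates the quotient too, and then the same argument with the roles
  exchanged gives the expansion along \<open>us\<close>. These expansions yield both the second basis and the
  entries of the multiplication matrices.
\<close>

lemma dual_expansion_right:
  assumes "length vs = length us"
    and dual: "\<And>i j. i < length us \<Longrightarrow> j < length us \<Longrightarrow>
      ip \<tau> (us ! i) (vs ! j) = (if i = j then 1 else 0)"
    and span: "\<And>f. \<exists>u\<in>mpol.span (set us). f - u \<in> ann \<tau>"
  shows "f - (\<Sum>i<length us. pscale (ip \<tau> f (us ! i)) (vs ! i)) \<in> ann \<tau>"
    (is "?g \<in> _")
  unfolding in_ann
proof
  fix h
  obtain u where u: "u \<in> mpol.span (set us)" "h - u \<in> ann \<tau>" using span by blast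
  have orth: "ip \<tau> ?g (us ! j) = 0" if "j < length us" for j
  proof -
    have "(\<Sum>i<length us. ip \<tau> f (us ! i) * ip \<tau> (vs ! i) (us ! j))
        = (\<Sum>i<length us. if i = j then ip \<tau> f (us ! j) else 0)"
      by (rule sum.cong) (auto simp: ip_commute[of \<tau> "vs ! _"] dual that)
    then show ?thesis
      using that by (simp add: ip_diff_left ip_sum_left ip_pscale_left)
  qed
  have "ip \<tau> ?g u = 0"
    by (rule ip_span_right_eq_0[OF _ u(1)]) (auto simp: in_set_conv_nth orth)
  moreover have "ip \<tau> (h - u) ?g = 0" using u(2) unfolding in_ann by blast
  ultimately show "ip \<tau> ?g h = 0"
    unfolding ip_diff_left[of \<tau> h u] by (simp only: ip_commute[of \<tau> _ ?g] diff_zero)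
qed

lemma dual_expansion_left:
  assumes "length vs = length us"
    and dual: "\<And>i j. i < length us \<Longrightarrow> j < length us \<Longrightarrow>
      ip \<tau> (us ! i) (vs ! j) = (if i = j then 1 else 0)"
    and span: "\<And>f. \<exists>u\<in>mpol.span (set us). f - u \<in> ann \<tau>"
  shows "f - (\<Sum>i<length us. pscale (ip \<tau> f (vs ! i)) (us ! i)) \<in> ann \<tau>"
    (is "?g \<in> _")
  unfolding in_ann
proof
  fix h
  let ?h = "\<Sum>i<length us. pscale (ip \<tau> h (us ! i)) (vs ! i)"
  have orth: "ip \<tau> ?g (vs ! j) = 0" if "j < length us" for j
  proof -
    have "(\<Sum>i<length us. ip \<tau> f (vs ! i) * ip \<tau> (us ! i) (vs ! j))
        = (\<Sum>i<length us. if i = j then ip \<tau> f (vs ! j) else 0)"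
      by (rule sum.cong) (auto simp: dual that)
    then show ?thesis
      using that by (simp add: ip_diff_left ip_sum_left ip_pscale_left)
  qed
  have "?h \<in> mpol.span ((!) vs ` {..<length us})"
    by (intro mpol.span_sum mpol.span_scale mpol.span_base) auto
  then have "ip \<tau> ?g ?h = 0"
    by (rule ip_span_right_eq_0[rotated]) (auto simp: orth)
  moreover have "ip \<tau> (h - ?h) ?g = 0"
    using dual_expansion_right[OF assms, of h] unfolding in_ann by blast
  ultimately show "ip \<tau> ?g h = 0"
    unfolding ip_diff_left[of \<tau> h ?h] by (simp only: ip_commute[of \<tau> _ ?g] diff_zero)
qed

section \<open>Flat extension of a truncated series\<close>

text \<open>
  The data that the algorithm delivers, freed from the order of the computation. On the span of
  \<open>plus_set B\<close>, the border polynomials \<open>p \<alpha>\<close> are in the kernel of the truncated Hankel operator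
  with test monomials \<open>b'\<close>, while \<open>dual\<close> makes the pairing of the spans of \<open>B\<close> and \<open>C\<close>
  nondegenerate: the rank does not grow from \<open>B\<close> to \<open>plus_set B\<close>.
\<close>

locale flat_data =
  fixes \<sigma> :: "('n::finite, 'k::field) series"
    and B C b' :: "'n expo set"
    and p q :: "'n expo \<Rightarrow> ('n, 'k) mpol"
  assumes finite_B: "finite B"
    and connected_B: "connected_to_0 B"
    and connected_b': "connected_to_0 b'"
    and plus_C: "plus_set C \<subseteq> b'"
    and p_span: "\<beta> \<in> B \<Longrightarrow> p \<beta> \<in> mpol.span (xpow ` B)"
    and xpow_span: "\<beta> \<in> B \<Longrightarrow> xpow \<beta> \<in> mpol.span (p ` B)"
    and q_span: "\<beta> \<in> B \<Longrightarrow> q \<beta> \<in> mpol.span (xpow ` C)"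
    and dual: "\<beta> \<in> B \<Longrightarrow> \<beta>' \<in> B \<Longrightarrow> ip \<sigma> (p \<beta>) (q \<beta>') = (if \<beta> = \<beta>' then 1 else 0)"
    and border_monic: "\<alpha> \<in> border B \<Longrightarrow> p \<alpha> - xpow \<alpha> \<in> mpol.span (xpow ` B)"
    and border_orth: "\<alpha> \<in> border B \<Longrightarrow> \<gamma> \<in> b' \<Longrightarrow> ip \<sigma> (p \<alpha>) (xpow \<gamma>) = 0"
begin

abbreviation "V \<equiv> mpol.span (xpow ` B) :: ('n, 'k) mpol set"
abbreviation "W \<equiv> mpol.span (xpow ` plus_set B) :: ('n, 'k) mpol set"
abbreviation "K \<equiv> mpol.span (p ` border B)"

lemma C_subset: "C \<subseteq> b'"
  using subset_plus_set plus_C by blast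

lemma V_subset_W: "V \<subseteq> W"
  by (intro mpol.span_mono image_mono subset_plus_set)

lemma span_p: "mpol.span (p ` B) = V"
  using p_span xpow_span by (intro equalityI mpol.span_minimal) auto

text \<open>
  The expansion in the dual pair. On \<open>W\<close> it is the projection onto \<open>V\<close> along the span \<open>K\<close> of the
  border polynomials; writing it with \<open>ip\<close> defines it, linearly, on all polynomials.
\<close>

definition \<pi> :: "('n, 'k) mpol \<Rightarrow> ('n, 'k) mpol" where
  "\<pi> f = (\<Sum>\<beta>\<in>B. pscale (ip \<sigma> f (q \<beta>)) (p \<beta>))"

lemma linear_\<pi>: "Vector_Spaces.linear pscale pscale \<pi>"
  by unfold_locales
    (simp_all add: \<pi>_def ip_add_left ip_pscale_left mpol.scale_left_distrib sum.distrib
      mpol.scale_sum_right)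

lemmas \<pi>_add = mpol_pair.linear_add[OF linear_\<pi>]
  and \<pi>_diff = mpol_pair.linear_diff[OF linear_\<pi>]
  and \<pi>_scale = mpol_pair.linear_scale[OF linear_\<pi>]
  and \<pi>_0 = mpol_pair.linear_0[OF linear_\<pi>]

lemma \<pi>_in_V: "\<pi> f \<in> V"
  unfolding \<pi>_def by (intro mpol.span_sum mpol.span_scale p_span)

lemma \<pi>_fix: "\<pi> v = v" if "v \<in> V"
  using that unfolding span_p[symmetric]
proof (induction rule: mpol.span_induct_alt)
  case base
  show ?case by (rule \<pi>_0)
next
  case (step c f g)
  then obtain \<beta> where \<beta>: "f = p \<beta>" "\<beta> \<in> B" by auto
  have "\<pi> f = (\<Sum>\<beta>'\<in>B. if \<beta> = \<beta>' then p \<beta> else 0)"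
    unfolding \<pi>_def by (rule sum.cong) (auto simp: \<beta> dual)
  then show ?case
    using step \<beta> finite_B by (simp add: \<pi>_add \<pi>_scale)
qed

lemma \<pi>_border: "\<pi> (p \<alpha>) = 0" if "\<alpha> \<in> border B"
proof -
  have "ip \<sigma> (p \<alpha>) (q \<beta>) = 0" if "\<beta> \<in> B" for \<beta>
    by (rule ip_span_right_eq_0[OF _ q_span[OF that]])
      (use border_orth \<open>\<alpha> \<in> border B\<close> C_subset in auto)
  then show ?thesis by (simp add: \<pi>_def)
qed

lemma diff_\<pi>_in_K: "f - \<pi> f \<in> K" if "f \<in> W"
  using that
proof (induction rule: mpol.span_induct_alt)
  case base
  show ?case by (simp add: \<pi>_0 mpol.span_zero)
next
  case (step c f g)
  then obtain \<alpha> where \<alpha>: "f = xpow \<alpha>" "\<alpha> \<in> plus_set B" by auto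
  have "xpow \<alpha> - \<pi> (xpow \<alpha>) \<in> K"
  proof (cases "\<alpha> \<in> B")
    case True
    then have "\<pi> (xpow \<alpha>) = xpow \<alpha>"
      by (intro \<pi>_fix mpol.span_base) auto
    then show ?thesis by (simp add: mpol.span_zero)
  next
    case False
    then have "\<alpha> \<in> border B" using \<alpha> by (simp add: border_def)
    moreover from this have "- \<pi> (xpow \<alpha>) = p \<alpha> - xpow \<alpha>"
      using \<pi>_fix[OF border_monic, of \<alpha>] by (simp add: \<pi>_diff \<pi>_border)
    then have "xpow \<alpha> - \<pi> (xpow \<alpha>) = p \<alpha>"
      unfolding diff_conv_add_uminus[of "xpow \<alpha>" "\<pi> (xpow \<alpha>)"] by simp
    ultimately show ?thesis by (auto intro: mpol.span_base)
  qed
  moreover have "pscale c f + g - \<pi> (pscale c f + g) = pscale c (f - \<pi> f) + (g - \<pi> g)"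
    by (simp add: \<pi>_add \<pi>_scale mpol.scale_right_diff_distrib)
  ultimately show ?case
    using step.IH unfolding \<alpha>(1)
    by (simp only:) (intro mpol.span_add mpol.span_scale, assumption+)
qed

text \<open>
  Projecting changes \<open>f\<close> by a combination of border polynomials, which the test monomials do not see.
\<close>

lemma ip_\<pi>: "ip \<sigma> (\<pi> f) (xpow \<gamma>) = ip \<sigma> f (xpow \<gamma>)" if "f \<in> W" "\<gamma> \<in> b'"
proof -
  have "ip \<sigma> (xpow \<gamma>) (f - \<pi> f) = 0"
    by (rule ip_span_right_eq_0[OF _ diff_\<pi>_in_K[OF that(1)]])
      (use border_orth that(2) in \<open>auto simp: ip_commute\<close>)
  then show ?thesis by (simp add: ip_commute[of \<sigma> "xpow \<gamma>"] ip_diff_left)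
qed

lemma nondegenerate: "v = 0" if "v \<in> V" "\<And>\<gamma>. \<gamma> \<in> C \<Longrightarrow> ip \<sigma> v (xpow \<gamma>) = 0"
proof -
  have "ip \<sigma> v (q \<beta>) = 0" if "\<beta> \<in> B" for \<beta>
    by (rule ip_span_right_eq_0[OF _ q_span[OF that]]) (use \<open>\<And>\<gamma>. _ \<Longrightarrow> _\<close> in auto)
  then have "\<pi> v = 0" by (simp add: \<pi>_def)
  then show ?thesis using \<pi>_fix[OF that(1)] by simp
qed

text \<open>
  This will be multiplication by the k-th variable on the quotient, read in \<open>V\<close>.
\<close>

definition M :: "'n \<Rightarrow> ('n, 'k) mpol \<Rightarrow> ('n, 'k) mpol" where
  "M k f = \<pi> (xpow (unit_expo k) * f)"

lemma linear_M: "Vector_Spaces.linear pscale pscale (M k)"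
  unfolding M_def
  using Vector_Spaces.linear_compose[OF linear_mult linear_\<pi>] by (simp add: o_def)

lemma M_in_V: "M k f \<in> V"
  by (simp add: M_def \<pi>_in_V)

lemma unit_mult_in_W: "xpow (unit_expo k) * v \<in> W" if "v \<in> V"
proof -
  have "mpol.span (xpow ` (+) (unit_expo k) ` B) \<subseteq> W"
    by (intro mpol.span_mono image_mono) (auto simp: unit_expo_plus_set)
  then show ?thesis using xpow_mult_span[OF that] by blast
qed

lemma ip_M: "ip \<sigma> (M k v) (xpow \<gamma>) = ip \<sigma> v (xpow (unit_expo k + \<gamma>))"
  if "v \<in> V" "\<gamma> \<in> b'"
  using ip_\<pi>[OF unit_mult_in_W[OF that(1)] that(2)]
  by (simp add: M_def ip_mult_left xpow_mult)

text \<open>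
  The heart of the matter. Testing \<open>M j (M k v)\<close> against a monomial with exponent \<open>\<gamma>\<close> in \<open>C\<close> moves the
  variables one after the other to the other side of the pairing, which gives the symmetric expression
  \<open>ip \<sigma> v\<close> of the monomial with exponent \<open>e\<^sub>k + e\<^sub>j + \<gamma>\<close>. The second move is legitimate because
  \<open>e\<^sub>j + \<gamma>\<close> lies in \<open>b'\<close>; this is where \<open>plus_set C \<subseteq> b'\<close> enters. Monomials from \<open>C\<close> separate
  the elements of \<open>V\<close>, so the two products agree.
\<close>

lemma M_commute: "M j (M k v) = M k (M j v)" if "v \<in> V"
proof -
  have "ip \<sigma> (M i (M j v)) (xpow \<gamma>) = ip \<sigma> v (xpow (unit_expo j + (unit_expo i + \<gamma>)))"
    if "\<gamma> \<in> C" for i j \<gamma>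
  proof -
    have "\<gamma> \<in> b'" "unit_expo i + \<gamma> \<in> b'"
      using that C_subset plus_C unit_expo_plus_set[of \<gamma> C i] by blast+
    then show ?thesis
      by (simp add: ip_M M_in_V \<open>v \<in> V\<close>)
  qed
  then have "M j (M k v) - M k (M j v) = 0"
    by (intro nondegenerate mpol.span_diff M_in_V)
      (simp_all add: ip_diff_left add.left_commute)
  then show ?thesis by simp
qed

text \<open>
  The commuting operators turn \<open>V\<close> into a module over the polynomials, and \<open>\<phi> f\<close> is the result of
  letting \<open>f\<close> act on 1.
\<close>

lemma normal_form_exists:
  obtains \<phi> where "Vector_Spaces.linear pscale pscale \<phi>"
    and "\<And>f. \<phi> f \<in> V" and "\<phi> 1 = 1"
    and "\<And>k f. \<phi> (xpow (unit_expo k) * f) = M k (\<phi> f)"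
proof -
  have "1 \<in> V"
    using connected_B unfolding connected_to_0_def
    by (metis xpow_0 image_eqI mpol.span_base)
  then obtain g where g: "g 0 = 1" "\<And>\<alpha>. g \<alpha> \<in> V" "\<And>k \<alpha>. g (unit_expo k + \<alpha>) = M k (g \<alpha>)"
    using commuting_orbit[of 1 V M] M_in_V M_commute by blast
  obtain \<phi> where \<phi>: "Vector_Spaces.linear pscale pscale \<phi>"
    and "\<And>x. x \<in> range xpow \<Longrightarrow> \<phi> x = g (inv_into UNIV xpow x)"
    using mpol_pair.linear_independent_extend[OF independent_xpow, of "\<lambda>x. g (inv_into UNIV xpow x)"]
    by blast
  then have \<phi>_xpow: "\<phi> (xpow \<alpha>) = g \<alpha>" for \<alpha>
    by (simp add: inv_f_f[OF inj_xpow])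
  note lin = Vector_Spaces.linear_compose
  show thesis
  proof
    show "Vector_Spaces.linear pscale pscale \<phi>" by fact
    show "\<phi> 1 = 1" using \<phi>_xpow[of 0] by (simp add: xpow_0 g)
    fix f :: "('n, 'k) mpol"
    have f: "f \<in> mpol.span (range xpow)" by (simp add: span_xpow_UNIV)
    then show "\<phi> f \<in> V"
      by (induction rule: mpol.span_induct_alt)
        (auto simp: mpol_pair.linear_add[OF \<phi>] mpol_pair.linear_scale[OF \<phi>]
          mpol_pair.linear_0[OF \<phi>] \<phi>_xpow g(2) mpol.span_zero
          intro!: mpol.span_add mpol.span_scale)
    fix k
    have "(\<phi> \<circ> (*) (xpow (unit_expo k))) f = (M k \<circ> \<phi>) f"
      by (rule mpol_pair.linear_eq_on[OF lin[OF linear_mult \<phi>] lin[OF \<phi> linear_M] f])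
        (auto simp: \<phi>_xpow xpow_mult g(3))
    then show "\<phi> (xpow (unit_expo k) * f) = M k (\<phi> f)" by simp
  qed
qed

end

locale flat_normal_form = flat_data \<sigma> B C b' p q
  for \<sigma> :: "('n::finite, 'k::field) series" and B C b' p q +
  fixes \<phi> :: "('n, 'k) mpol \<Rightarrow> ('n, 'k) mpol"
  assumes linear_\<phi>: "Vector_Spaces.linear pscale pscale \<phi>"
    and \<phi>_in_V: "\<phi> f \<in> V"
    and \<phi>_1: "\<phi> 1 = 1"
    and \<phi>_unit: "\<phi> (xpow (unit_expo k) * f) = M k (\<phi> f)"
begin

lemmas \<phi>_add = mpol_pair.linear_add[OF linear_\<phi>]
  and \<phi>_diff = mpol_pair.linear_diff[OF linear_\<phi>]
  and \<phi>_scale = mpol_pair.linear_scale[OF linear_\<phi>]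
  and \<phi>_0 = mpol_pair.linear_0[OF linear_\<phi>]

text \<open>
  Here connectedness of \<open>B\<close> is used: a monomial of \<open>B\<close> is reached from 1 by multiplications that stay
  inside \<open>V\<close>, where projecting does nothing. Hence \<open>\<phi>\<close> is a projection onto \<open>V\<close>.
\<close>

lemma \<phi>_fix: "\<phi> v = v" if "v \<in> V"
proof -
  have "\<phi> (xpow \<beta>) = xpow \<beta>" if "\<beta> \<in> B" for \<beta>
    using connected_B that
  proof (induction rule: connected_induct)
    case zero
    then show ?case by (simp add: xpow_0 \<phi>_1)
  next
    case (step \<beta> i)
    have "\<phi> (xpow (unit_expo i) * xpow \<beta>) = \<pi> (xpow (unit_expo i) * xpow \<beta>)"
      by (simp add: \<phi>_unit step.IH M_def)
    also have "\<dots> = xpow (unit_expo i) * xpow \<beta>"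
      using step.hyps by (intro \<pi>_fix) (auto simp: xpow_mult intro: mpol.span_base)
    finally show ?case by (simp add: xpow_mult)
  qed
  then show ?thesis
    by (intro mpol_pair.linear_eq_on[OF linear_\<phi> mpol.linear_ident that]) auto
qed

lemma \<phi>_W: "\<phi> f = \<pi> f" if "f \<in> W"
proof (rule mpol_pair.linear_eq_on[OF linear_\<phi> linear_\<pi> that])
  fix f :: "('n, 'k) mpol"
  assume "f \<in> xpow ` plus_set B"
  then consider \<beta> where "\<beta> \<in> B" "f = xpow \<beta>" | \<beta> i where "\<beta> \<in> B" "f = xpow (unit_expo i) * xpow \<beta>"
    by (auto simp: plus_set_def xpow_mult)
  then show "\<phi> f = \<pi> f"
    by cases (simp_all add: \<phi>_unit M_def \<phi>_fix \<pi>_fix mpol.span_base)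
qed

text \<open>
  The kernel of \<open>\<phi>\<close> is an ideal, because \<open>\<phi>\<close> intertwines multiplication by a variable with
  the operator \<open>M k\<close>.
\<close>

lemma \<phi>_kernel: "\<phi> (g * f) = 0" if "\<phi> f = 0"
proof -
  have "\<phi> (xpow \<alpha> * f) = 0" for \<alpha>
    using connected_UNIV UNIV_I
  proof (induction \<alpha> rule: connected_induct)
    case (step \<beta> i)
    have "\<phi> (xpow (unit_expo i) * (xpow \<beta> * f)) = 0"
      unfolding \<phi>_unit step.IH by (rule mpol_pair.linear_0[OF linear_M])
    then show ?case by (simp add: mult.assoc[symmetric] xpow_mult)
  qed (simp add: xpow_0 that)
  note xpow = this
  have "g \<in> mpol.span (range xpow)" by (simp add: span_xpow_UNIV)
  then show ?thesis
    by (induction rule: mpol.span_induct_alt)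
      (auto simp: xpow \<phi>_0 \<phi>_add \<phi>_scale ring_distribs pscale_mult)
qed

lemma \<phi>_\<phi>: "\<phi> (\<phi> f) = \<phi> f"
  by (rule \<phi>_fix[OF \<phi>_in_V])

lemma \<phi>_mult_cong: "\<phi> (g * f) = \<phi> (g * h)" if "\<phi> f = \<phi> h"
  using \<phi>_kernel[of "f - h" g] that by (simp add: \<phi>_diff right_diff_distrib)

text \<open>
  The extended series is the linear form \<open>\<sigma>\<close> evaluated on normal forms. By construction it
  vanishes on the kernel of \<open>\<phi>\<close>, an ideal, which therefore lies in its annihilator.
\<close>

definition \<tau> :: "('n, 'k) series" where
  "\<tau> \<alpha> = pairing \<sigma> (\<phi> (xpow \<alpha>))"

lemma pairing_\<tau>: "pairing \<tau> f = pairing \<sigma> (\<phi> f)"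
proof -
  have "f \<in> mpol.span (range xpow)" by (simp add: span_xpow_UNIV)
  then show ?thesis
    by (induction rule: mpol.span_induct_alt)
      (auto simp: \<phi>_0 \<phi>_add \<phi>_scale pairing_add pairing_pscale pairing_xpow \<tau>_def)
qed

text \<open>
  Induction along \<open>b'\<close>. To treat \<open>f\<close> against \<open>e\<^sub>i + \<gamma>\<close>, first replace \<open>f\<close> by \<open>\<pi> f\<close>, which
  changes neither side, and then move the i-th variable over to \<open>\<pi> f\<close>. The product is again in \<open>W\<close>
  because \<open>\<pi> f\<close> is in \<open>V\<close>; without the projection the left factor would leave \<open>W\<close>.
\<close>

lemma \<tau>_agrees: "ip \<tau> f (xpow \<gamma>) = ip \<sigma> f (xpow \<gamma>)" if "f \<in> W" "\<gamma> \<in> b'"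
proof -
  have "\<forall>f\<in>W. ip \<tau> f (xpow \<gamma>) = ip \<sigma> f (xpow \<gamma>)"
    using connected_b' that(2)
  proof (induction rule: connected_induct)
    case zero
    have "0 \<in> b'" using connected_b' by (simp add: connected_to_0_def)
    then show ?case
      using ip_\<pi>[of _ 0] by (simp add: ip_def xpow_0 pairing_\<tau> \<phi>_W)
  next
    case (step \<gamma> i)
    show ?case
    proof
      fix f assume f: "f \<in> W"
      let ?x = "xpow (unit_expo i + \<gamma>)"
      have "ip \<tau> f ?x = ip \<tau> (\<pi> f) ?x"
        using \<phi>_mult_cong[of f "\<pi> f" ?x] f
        by (simp add: ip_def pairing_\<tau> \<phi>_W \<phi>_fix[OF \<pi>_in_V] mult.commute)
      also have "\<dots> = ip \<tau> (xpow (unit_expo i) * \<pi> f) (xpow \<gamma>)"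
        by (simp add: ip_mult_left xpow_mult)
      also have "\<dots> = ip \<sigma> (xpow (unit_expo i) * \<pi> f) (xpow \<gamma>)"
        using step.IH unit_mult_in_W[OF \<pi>_in_V] by blast
      also have "\<dots> = ip \<sigma> (\<pi> f) ?x"
        by (simp add: ip_mult_left xpow_mult)
      also have "\<dots> = ip \<sigma> f ?x"
        by (rule ip_\<pi>[OF f step.hyps(2)])
      finally show "ip \<tau> f ?x = ip \<sigma> f ?x" .
    qed
  qed
  then show ?thesis using that(1) by blast
qed

lemma \<tau>_agrees_q: "ip \<tau> f (q \<beta>) = ip \<sigma> f (q \<beta>)" if "f \<in> W" "\<beta> \<in> B"
  using q_span[OF that(2)]
proof (induction rule: mpol.span_induct_alt)
  case (step c g h)
  then show ?case
    using \<tau>_agrees[OF that(1)] C_subset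
    by (auto simp: ip_commute[of _ f] ip_add_left ip_pscale_left)
qed (simp add: ip_def)

text \<open>
  If \<open>f\<close> is in the annihilator then so is its normal form, which lies in \<open>V\<close>; there \<open>\<tau>\<close> and \<open>\<sigma>\<close>
  agree against monomials from \<open>C\<close>, and these separate \<open>V\<close>.
\<close>

lemma in_ann_iff: "f \<in> ann \<tau> \<longleftrightarrow> \<phi> f = 0"
proof
  assume "\<phi> f = 0"
  then have "\<phi> (f * g) = 0" for g
    using \<phi>_kernel[of f g] by (simp add: mult.commute)
  then show "f \<in> ann \<tau>"
    by (simp add: ann_def hankel_def pairing_\<tau>)
next
  assume "f \<in> ann \<tau>"
  then have f: "ip \<tau> f g = 0" for g
    unfolding ann_def hankel_def ip_def by (simp add: fun_eq_iff)
  have "ip \<sigma> (\<phi> f) (xpow \<gamma>) = 0" if "\<gamma> \<in> C" for \<gamma>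
  proof -
    have "ip \<sigma> (\<phi> f) (xpow \<gamma>) = ip \<tau> (\<phi> f) (xpow \<gamma>)"
      using \<tau>_agrees \<phi>_in_V V_subset_W C_subset that by (metis subsetD)
    also have "\<dots> = ip \<tau> f (xpow \<gamma>)"
      using \<phi>_mult_cong[OF \<phi>_\<phi>, of "xpow \<gamma>" f] by (simp add: ip_def pairing_\<tau> mult.commute)
    finally show ?thesis by (simp add: f)
  qed
  then show "\<phi> f = 0" by (rule nondegenerate[OF \<phi>_in_V])
qed

text \<open>
  Reduction to normal form only subtracts multiples of the border polynomials, as one sees by multiplying
  with one variable at a time. So every ideal \<open>J\<close> that contains the border polynomials contains
  the kernel of \<open>\<phi>\<close>.
\<close>

lemma diff_\<phi>_in_ideal:
  assumes p: "p ` border B \<subseteq> J" and J0: "0 \<in> J"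
    and add: "\<And>f g. f \<in> J \<Longrightarrow> g \<in> J \<Longrightarrow> f + g \<in> J" and mult: "\<And>f g. f \<in> J \<Longrightarrow> g * f \<in> J"
  shows "f - \<phi> f \<in> J"
proof -
  have J: "mpol.subspace J"
    using J0 add mult by (auto simp: mpol.subspace_def pscale_def)
  have KJ: "K \<subseteq> J" by (rule mpol.span_minimal[OF p J])
  have xpow: "xpow \<alpha> - \<phi> (xpow \<alpha>) \<in> J" for \<alpha>
    using connected_UNIV UNIV_I
  proof (induction \<alpha> rule: connected_induct)
    case (step \<beta> i)
    let ?x = "xpow (unit_expo i)" and ?v = "\<phi> (xpow \<beta>)"
    have "?x * ?v - \<pi> (?x * ?v) \<in> J"
      using diff_\<pi>_in_K[OF unit_mult_in_W[OF \<phi>_in_V]] KJ by blast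
    moreover have "?x * (xpow \<beta> - ?v) \<in> J" by (rule mult[OF step.IH])
    moreover have "xpow (unit_expo i + \<beta>) - \<phi> (xpow (unit_expo i + \<beta>))
        = ?x * (xpow \<beta> - ?v) + (?x * ?v - \<pi> (?x * ?v))"
      by (simp add: xpow_mult[symmetric] \<phi>_unit M_def right_diff_distrib)
    ultimately show ?case using add by metis
  qed (simp add: xpow_0 \<phi>_1 J0)
  have "f \<in> mpol.span (range xpow)" by (simp add: span_xpow_UNIV)
  then show ?thesis
  proof (induction rule: mpol.span_induct_alt)
    case (step c g h)
    have "pscale c g + h - \<phi> (pscale c g + h) = pscale c (g - \<phi> g) + (h - \<phi> h)"
      by (simp add: \<phi>_add \<phi>_scale mpol.scale_right_diff_distrib)
    moreover have "pscale c (g - \<phi> g) \<in> J"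
      using step(1) xpow by (auto intro: mpol.subspace_scale[OF J])
    ultimately show ?case using add step(2) by metis
  qed (simp add: \<phi>_0 J0)
qed

end

section \<open>Invariants of the algorithm\<close>

lemma proj_snoc:
  "proj \<sigma> f (map p (b @ [\<beta>])) (map m (b @ [\<beta>])) =
    (let g = proj \<sigma> f (map p b) (map m b) in g - pscale (ip \<sigma> g (m \<beta>)) (p \<beta>))"
  by (simp add: proj_def Let_def)

lemma proj_diff_span: "proj \<sigma> f (map p b) (map m b) - f \<in> mpol.span (p ` set b)"
proof (induction b rule: rev_induct)
  case Nil
  show ?case by (simp add: proj_def mpol.span_zero)
next
  case (snoc \<beta> b)
  let ?g = "proj \<sigma> f (map p b) (map m b)"
  have "?g - f \<in> mpol.span (p ` set (b @ [\<beta>]))"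
    using snoc mpol.span_mono[of "p ` set b" "p ` set (b @ [\<beta>])"] by auto
  moreover have "pscale (ip \<sigma> ?g (m \<beta>)) (p \<beta>) \<in> mpol.span (p ` set (b @ [\<beta>]))"
    by (intro mpol.span_scale mpol.span_base) auto
  ultimately have "(?g - f) - pscale (ip \<sigma> ?g (m \<beta>)) (p \<beta>) \<in> mpol.span (p ` set (b @ [\<beta>]))"
    by (rule mpol.span_diff)
  then show ?case
    unfolding proj_snoc Let_def by (simp add: algebra_simps)
qed

text \<open>
  Gram-Schmidt with two families. Subtracting along \<open>p \<beta>\<close> kills the pairing with \<open>m \<beta>\<close> and does not
  revive the earlier ones, since \<open>p \<beta>\<close> is orthogonal to every earlier \<open>m \<beta>'\<close>. The order in the
  \<open>sorted_wrt\<close> hypothesis expresses this triangularity.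
\<close>

lemma proj_orthogonal:
  assumes "sorted_wrt (\<lambda>\<beta>' \<beta>. ip \<sigma> (p \<beta>) (m \<beta>') = 0) b"
    and "\<And>\<beta>. \<beta> \<in> set b \<Longrightarrow> ip \<sigma> (p \<beta>) (m \<beta>) = 1"
    and "\<beta> \<in> set b"
  shows "ip \<sigma> (proj \<sigma> f (map p b) (map m b)) (m \<beta>) = 0"
  using assms
proof (induction b rule: rev_induct)
  case (snoc \<alpha> b)
  let ?g = "proj \<sigma> f (map p b) (map m b)"
  show ?case
  proof (cases "\<beta> = \<alpha>")
    case True
    then show ?thesis
      unfolding proj_snoc Let_def using snoc.prems(2)[of \<alpha>]
      by (simp add: ip_diff_left ip_pscale_left)
  next
    case False
    then have "ip \<sigma> ?g (m \<beta>) = 0" "ip \<sigma> (p \<alpha>) (m \<beta>) = 0"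
      using snoc by (auto simp: sorted_wrt_append)
    then show ?thesis
      unfolding proj_snoc Let_def by (simp add: ip_diff_left ip_pscale_left)
  qed
qed simp

text \<open>
  The invariant of the main loop, on the components of the state. The family \<open>m\<close> is dual to \<open>p\<close> only
  in the triangular sense; \<open>q\<close> is its orthogonalization and fully dual. The condition \<open>d_orth\<close> covers every
  \<open>\<gamma>\<close> of \<open>a\<close>, although the search runs over \<open>t\<close> alone: the exponents already moved to \<open>c\<close> are
  handled by orthogonality to \<open>m\<close>.
\<close>

locale agbb_invariant =
  fixes a :: "('n::finite) expo list" and \<sigma> :: "('n, 'k::field) series"
    and b c d t :: "'n expo list" and p m q :: "'n expo \<Rightarrow> ('n, 'k) mpol"
  assumes distinct_b: "distinct b"
    and disjoint_b_d: "set b \<inter> set d = {}"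
    and triangular: "sorted_wrt (\<lambda>\<beta>' \<beta>. ip \<sigma> (p \<beta>) (m \<beta>') = 0) b"
    and normalized: "\<beta> \<in> set b \<Longrightarrow> ip \<sigma> (p \<beta>) (m \<beta>) = 1"
    and dual: "\<beta> \<in> set b \<Longrightarrow> \<beta>' \<in> set b \<Longrightarrow> ip \<sigma> (p \<beta>) (q \<beta>') = (if \<beta> = \<beta>' then 1 else 0)"
    and span_p: "mpol.span (p ` set b) = mpol.span (xpow ` set b)"
    and span_m: "mpol.span (m ` set b) = mpol.span (xpow ` set c)"
    and q_span: "\<beta> \<in> set b \<Longrightarrow> q \<beta> \<in> mpol.span (m ` set b)"
    and t_or_c: "\<gamma> \<in> set a \<Longrightarrow> \<gamma> \<in> set t \<or> \<gamma> \<in> set c"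
    and d_monic: "\<alpha> \<in> set d \<Longrightarrow> p \<alpha> - xpow \<alpha> \<in> mpol.span (xpow ` set b)"
    and d_orth: "\<alpha> \<in> set d \<Longrightarrow> \<gamma> \<in> set a \<Longrightarrow> xpow \<gamma> * p \<alpha> \<in> mpol.span (xpow ` set a) \<Longrightarrow>
      ip \<sigma> (p \<alpha>) (xpow \<gamma>) = 0"
    and b_connected: "\<alpha> \<in> set b \<Longrightarrow> \<alpha> = 0 \<or> (\<exists>\<beta>\<in>set b. \<exists>i. \<alpha> = \<beta> + unit_expo i)"
begin

context
  fixes \<alpha> :: "'n expo" and p\<^sub>\<alpha>
  assumes fresh: "\<alpha> \<notin> set b" "\<alpha> \<notin> set d"
    and reach: "\<alpha> = 0 \<or> \<alpha> \<in> plus_set (set b)"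
  defines "p\<^sub>\<alpha> \<equiv> proj \<sigma> (xpow \<alpha>) (map p b) (map m b)"
begin

lemma new_p_monic: "p\<^sub>\<alpha> - xpow \<alpha> \<in> mpol.span (xpow ` set b)"
  using proj_diff_span[of \<sigma> "xpow \<alpha>" p b m] unfolding span_p p\<^sub>\<alpha>_def .

lemma new_p_orth: "\<beta> \<in> set b \<Longrightarrow> ip \<sigma> p\<^sub>\<alpha> (m \<beta>) = 0"
  unfolding p\<^sub>\<alpha>_def by (rule proj_orthogonal[OF triangular normalized])

lemma new_p_orth_span: "f \<in> mpol.span (m ` set b) \<Longrightarrow> ip \<sigma> p\<^sub>\<alpha> f = 0"
  by (rule ip_span_right_eq_0[of "m ` set b"]) (auto simp: new_p_orth)

text \<open>
  A rejected exponent has \<open>p\<^sub>\<alpha>\<close> orthogonal to all admissible monomials from \<open>a\<close>: those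
  from \<open>c\<close> lie in the span of \<open>m\<close>, the others failed the search.
\<close>

lemma invariant_reject:
  assumes none: "\<And>\<gamma>. \<gamma> \<in> set t \<Longrightarrow> \<not> (xpow \<gamma> * p\<^sub>\<alpha> \<in> mpol.span (xpow ` set a) \<and> ip \<sigma> p\<^sub>\<alpha> (xpow \<gamma>) \<noteq> 0)"
  shows "agbb_invariant a \<sigma> b c (d @ [\<alpha>]) t (p(\<alpha> := p\<^sub>\<alpha>)) m q"
proof
  have p: "(p(\<alpha> := p\<^sub>\<alpha>)) \<beta> = p \<beta>" if "\<beta> \<in> set b" for \<beta>
    using that fresh by auto
  show "sorted_wrt (\<lambda>\<beta>' \<beta>. ip \<sigma> ((p(\<alpha> := p\<^sub>\<alpha>)) \<beta>) (m \<beta>') = 0) b"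
    by (rule sorted_wrt_mono_rel[OF _ triangular]) (simp add: p del: fun_upd_apply)
  show "mpol.span (p(\<alpha> := p\<^sub>\<alpha>) ` set b) = mpol.span (xpow ` set b)"
    using span_p by (simp add: p cong: image_cong del: fun_upd_apply)
  fix \<delta> assume \<delta>: "\<delta> \<in> set (d @ [\<alpha>])"
  then show "(p(\<alpha> := p\<^sub>\<alpha>)) \<delta> - xpow \<delta> \<in> mpol.span (xpow ` set b)"
    using d_monic new_p_monic by auto
  fix \<gamma> assume \<gamma>: "\<gamma> \<in> set a" "xpow \<gamma> * (p(\<alpha> := p\<^sub>\<alpha>)) \<delta> \<in> mpol.span (xpow ` set a)"
  show "ip \<sigma> ((p(\<alpha> := p\<^sub>\<alpha>)) \<delta>) (xpow \<gamma>) = 0"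
  proof (cases "\<delta> = \<alpha>")
    case True
    have "ip \<sigma> p\<^sub>\<alpha> (xpow \<gamma>) = 0" if "\<gamma> \<in> set c"
      using that by (intro new_p_orth_span) (auto simp: span_m intro: mpol.span_base)
    then show ?thesis
      using True \<gamma> t_or_c none by auto
  qed (use \<delta> \<gamma> d_orth in auto)
qed (use distinct_b disjoint_b_d normalized dual span_m q_span t_or_c b_connected fresh in auto)

text \<open>
  Full duality survives the new vectors. The old \<open>q \<beta>\<close> lie in the span of \<open>m\<close>, to which
  \<open>p\<^sub>\<alpha>\<close> is orthogonal; \<open>q\<^sub>\<alpha>\<close> is orthogonal to the old \<open>p \<beta>\<close> by projection; and
  \<open>q\<^sub>\<alpha>\<close> differs from \<open>m\<^sub>\<alpha>\<close> by an element of that same span, so its pairing with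
  \<open>p\<^sub>\<alpha>\<close> is still 1.
\<close>

lemma invariant_accept:
  assumes "ip \<sigma> p\<^sub>\<alpha> (xpow \<gamma>) \<noteq> 0"
  defines "m\<^sub>\<alpha> \<equiv> pscale (1 / ip \<sigma> p\<^sub>\<alpha> (xpow \<gamma>)) (xpow \<gamma>)"
  defines "q\<^sub>\<alpha> \<equiv> proj \<sigma> m\<^sub>\<alpha> (map q b) (map p b)"
  shows "agbb_invariant a \<sigma> (b @ [\<alpha>]) (c @ [\<gamma>]) d (remove1 \<gamma> t)
    (p(\<alpha> := p\<^sub>\<alpha>)) (m(\<alpha> := m\<^sub>\<alpha>)) (q(\<alpha> := q\<^sub>\<alpha>))"
proof -
  let ?p = "p(\<alpha> := p\<^sub>\<alpha>)" and ?m = "m(\<alpha> := m\<^sub>\<alpha>)" and ?q = "q(\<alpha> := q\<^sub>\<alpha>)"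
  have old: "?p \<beta> = p \<beta>" "?m \<beta> = m \<beta>" "?q \<beta> = q \<beta>" if "\<beta> \<in> set b" for \<beta>
    using that fresh by auto
  have img: "?p ` set (b @ [\<alpha>]) = insert p\<^sub>\<alpha> (p ` set b)"
    "?m ` set (b @ [\<alpha>]) = insert m\<^sub>\<alpha> (m ` set b)"
    using fresh by auto
  have m_norm: "ip \<sigma> p\<^sub>\<alpha> m\<^sub>\<alpha> = 1"
    using assms(1) by (simp add: m\<^sub>\<alpha>_def ip_commute[of \<sigma> p\<^sub>\<alpha>] ip_pscale_left)
  have q_diff: "q\<^sub>\<alpha> - m\<^sub>\<alpha> \<in> mpol.span (m ` set b)"
  proof -
    have "mpol.span (q ` set b) \<subseteq> mpol.span (m ` set b)"
      using q_span by (intro mpol.span_minimal) auto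
    then show ?thesis
      using proj_diff_span[of \<sigma> m\<^sub>\<alpha> q b p] unfolding q\<^sub>\<alpha>_def by blast
  qed
  have q_tri: "sorted_wrt (\<lambda>\<beta>' \<beta>. ip \<sigma> (q \<beta>) (p \<beta>') = 0) b"
    unfolding sorted_wrt_iff_nth_less
    using distinct_b by (simp add: ip_commute[of \<sigma> _ "p _"] dual nth_eq_iff_index_eq)
  have pq: "ip \<sigma> (p \<beta>) q\<^sub>\<alpha> = 0" if "\<beta> \<in> set b" for \<beta>
    using proj_orthogonal[OF q_tri _ that] dual unfolding q\<^sub>\<alpha>_def
    by (simp add: ip_commute[of \<sigma> _ "p _"])
  have qp: "ip \<sigma> p\<^sub>\<alpha> (q \<beta>) = 0" if "\<beta> \<in> set b" for \<beta>
    using that by (intro new_p_orth_span q_span)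
  have "ip \<sigma> p\<^sub>\<alpha> (q\<^sub>\<alpha> - m\<^sub>\<alpha>) = 0"
    by (rule new_p_orth_span[OF q_diff])
  then have qq: "ip \<sigma> p\<^sub>\<alpha> q\<^sub>\<alpha> = 1"
    using m_norm by (simp add: ip_commute[of \<sigma> p\<^sub>\<alpha>] ip_diff_left)
  have mono: "mpol.span (xpow ` set b) \<subseteq> (mpol.span (xpow ` set (b @ [\<alpha>])) :: ('n, 'k) mpol set)"
    "mpol.span (m ` set b) \<subseteq> mpol.span (?m ` set (b @ [\<alpha>]))"
    unfolding img by (intro mpol.span_mono; auto)+
  show ?thesis
  proof
    show "distinct (b @ [\<alpha>])" "set (b @ [\<alpha>]) \<inter> set d = {}"
      using distinct_b disjoint_b_d fresh by auto
    have "sorted_wrt (\<lambda>\<beta>' \<beta>. ip \<sigma> (?p \<beta>) (?m \<beta>') = 0) b"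
      by (rule sorted_wrt_mono_rel[OF _ triangular]) (simp add: old del: fun_upd_apply)
    then show "sorted_wrt (\<lambda>\<beta>' \<beta>. ip \<sigma> (?p \<beta>) (?m \<beta>') = 0) (b @ [\<alpha>])"
      using new_p_orth fresh by (auto simp: sorted_wrt_append)
    show "mpol.span (?p ` set (b @ [\<alpha>])) = mpol.span (xpow ` set (b @ [\<alpha>]))"
    proof -
      have "mpol.span (insert p\<^sub>\<alpha> (p ` set b)) = mpol.span (insert (xpow \<alpha>) (p ` set b))"
        using new_p_monic by (intro mpol.eq_span_insert_eq) (simp add: span_p)
      then show ?thesis
        unfolding img by (simp add: mpol.span_insert span_p)
    qed
    show "mpol.span (?m ` set (b @ [\<alpha>])) = mpol.span (xpow ` set (c @ [\<gamma>]))"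
    proof (intro equalityI mpol.span_minimal mpol.subspace_span subsetI)
      have c: "mpol.span (xpow ` set c) \<subseteq> (mpol.span (xpow ` set (c @ [\<gamma>])) :: ('n, 'k) mpol set)"
        by (intro mpol.span_mono) auto
      fix f assume "f \<in> ?m ` set (b @ [\<alpha>])"
      then have "f = m\<^sub>\<alpha> \<or> f \<in> mpol.span (m ` set b)"
        unfolding img by (auto intro: mpol.span_base)
      then show "f \<in> mpol.span (xpow ` set (c @ [\<gamma>]))"
        using c by (auto simp: m\<^sub>\<alpha>_def span_m intro: mpol.span_scale mpol.span_base)
    next
      fix f :: "('n, 'k) mpol"
      assume "f \<in> xpow ` set (c @ [\<gamma>])"
      then consider "f = pscale (ip \<sigma> p\<^sub>\<alpha> (xpow \<gamma>)) m\<^sub>\<alpha>" | "f \<in> mpol.span (m ` set b)"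
        using assms(1) by (auto simp: m\<^sub>\<alpha>_def span_m intro: mpol.span_base)
      then show "f \<in> mpol.span (?m ` set (b @ [\<alpha>]))"
      proof cases
        case 1
        then show ?thesis by (auto intro: mpol.span_scale mpol.span_base)
      next
        case 2
        then show ?thesis using mono(2) by blast
      qed
    qed
    fix \<beta> assume \<beta>: "\<beta> \<in> set (b @ [\<alpha>])"
    show "ip \<sigma> (?p \<beta>) (?m \<beta>) = 1"
      using \<beta> normalized m_norm by auto
    show "ip \<sigma> (?p \<beta>) (?q \<beta>') = (if \<beta> = \<beta>' then 1 else 0)" if "\<beta>' \<in> set (b @ [\<alpha>])" for \<beta>'
      using \<beta> that fresh dual pq qp qq by auto
    show "?q \<beta> \<in> mpol.span (?m ` set (b @ [\<alpha>]))"
    proof (cases "\<beta> = \<alpha>")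
      case True
      have "(q\<^sub>\<alpha> - m\<^sub>\<alpha>) + m\<^sub>\<alpha> \<in> mpol.span (?m ` set (b @ [\<alpha>]))"
        using q_diff mono(2) by (intro mpol.span_add) (auto simp: img intro: mpol.span_base)
      then show ?thesis using True by simp
    qed (use \<beta> q_span mono(2) in auto)
    show "\<beta> = 0 \<or> (\<exists>\<beta>'\<in>set (b @ [\<alpha>]). \<exists>i. \<beta> = \<beta>' + unit_expo i)"
      using \<beta> b_connected reach fresh unfolding plus_set_def
      by (auto simp: add.commute[of "unit_expo _"])
  next
    show "\<gamma>' \<in> set (remove1 \<gamma> t) \<or> \<gamma>' \<in> set (c @ [\<gamma>])" if "\<gamma>' \<in> set a" for \<gamma>'
      using t_or_c[OF that] by (cases "\<gamma>' = \<gamma>") (simp_all add: in_set_remove1)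
    fix \<delta> assume \<delta>: "\<delta> \<in> set d"
    then have p: "?p \<delta> = p \<delta>" using fresh by auto
    show "?p \<delta> - xpow \<delta> \<in> mpol.span (xpow ` set (b @ [\<alpha>]))"
      unfolding p using d_monic[OF \<delta>] mono(1) by blast
    show "ip \<sigma> (?p \<delta>) (xpow \<gamma>') = 0"
      if "\<gamma>' \<in> set a" "xpow \<gamma>' * ?p \<delta> \<in> mpol.span (xpow ` set a)" for \<gamma>'
      using d_orth[OF \<delta>] that unfolding p by blast
  qed
qed

end
end

definition state_invariant ::
  "('n::finite) expo list \<Rightarrow> ('n, 'k::field) series \<Rightarrow> ('n, 'k) agbb_state \<Rightarrow> bool" where
  "state_invariant a \<sigma> S \<longleftrightarrow>
    agbb_invariant a \<sigma> (st_b S) (st_c S) (st_d S) (st_t S) (st_p S) (st_m S) (st_q S)"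

definition treated :: "('n, 'k) agbb_state \<Rightarrow> 'n expo set" where
  "treated S = set (st_b S) \<union> set (st_d S)"

lemma state_invariant_init: "state_invariant a \<sigma> (agbb_init a)"
  unfolding state_invariant_def agbb_init_def by unfold_locales auto

lemma agbb_treat_invariant:
  assumes "state_invariant a \<sigma> S" and "\<alpha> \<notin> treated S"
    and "\<alpha> = 0 \<or> \<alpha> \<in> plus_set (set (st_b S))"
  shows "state_invariant a \<sigma> (agbb_treat a \<sigma> \<alpha> S)"
    and "treated (agbb_treat a \<sigma> \<alpha> S) = insert \<alpha> (treated S)"
    and "set (st_b S) \<subseteq> set (st_b (agbb_treat a \<sigma> \<alpha> S))"
proof -
  interpret agbb_invariant a \<sigma> "st_b S" "st_c S" "st_d S" "st_t S" "st_p S" "st_m S" "st_q S"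
    using assms(1) unfolding state_invariant_def .
  have fresh: "\<alpha> \<notin> set (st_b S)" "\<alpha> \<notin> set (st_d S)"
    using assms(2) by (auto simp: treated_def)
  let ?p = "proj \<sigma> (xpow \<alpha>) (map (st_p S) (st_b S)) (map (st_m S) (st_b S))"
  let ?P = "\<lambda>\<gamma>. xpow \<gamma> * ?p \<in> mpol.span (xpow ` set a) \<and> ip \<sigma> ?p (xpow \<gamma>) \<noteq> 0"
  have "state_invariant a \<sigma> (agbb_treat a \<sigma> \<alpha> S) \<and>
    treated (agbb_treat a \<sigma> \<alpha> S) = insert \<alpha> (treated S) \<and>
    set (st_b S) \<subseteq> set (st_b (agbb_treat a \<sigma> \<alpha> S))"
  proof (cases "find ?P (st_t S)")
    case None
    then have "\<not> ?P \<gamma>" if "\<gamma> \<in> set (st_t S)" for \<gamma>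
      using that unfolding find_None_iff by blast
    from invariant_reject[OF fresh assms(3) this] show ?thesis
      using None by (auto simp: agbb_treat_def state_invariant_def treated_def)
  next
    case (Some \<gamma>)
    then have "ip \<sigma> ?p (xpow \<gamma>) \<noteq> 0"
      unfolding find_Some_iff by blast
    from invariant_accept[OF fresh assms(3) this] show ?thesis
      using Some by (auto simp: agbb_treat_def state_invariant_def treated_def Let_def)
  qed
  then show "state_invariant a \<sigma> (agbb_treat a \<sigma> \<alpha> S)"
    and "treated (agbb_treat a \<sigma> \<alpha> S) = insert \<alpha> (treated S)"
    and "set (st_b S) \<subseteq> set (st_b (agbb_treat a \<sigma> \<alpha> S))" by blast+
qed

text \<open>
  The exponents of one pass are fixed before the pass starts, but the basis grows during it. Membership in
  \<open>plus_set\<close> of the basis, rather than in its border, is stable under this growth.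
\<close>

lemma fold_agbb_treat_invariant:
  assumes "state_invariant a \<sigma> S" and "distinct n" and "set n \<inter> treated S = {}"
    and "\<forall>\<alpha>\<in>set n. \<alpha> = 0 \<or> \<alpha> \<in> plus_set (set (st_b S))"
  shows "state_invariant a \<sigma> (fold (agbb_treat a \<sigma>) n S) \<and>
    treated (fold (agbb_treat a \<sigma>) n S) = set n \<union> treated S"
  using assms
proof (induction n arbitrary: S)
  case (Cons \<alpha> n)
  let ?S = "agbb_treat a \<sigma> \<alpha> S"
  have S: "state_invariant a \<sigma> ?S" "treated ?S = insert \<alpha> (treated S)"
    "set (st_b S) \<subseteq> set (st_b ?S)"
    using Cons.prems by (intro agbb_treat_invariant; simp)+
  have "state_invariant a \<sigma> (fold (agbb_treat a \<sigma>) n ?S) \<and>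
    treated (fold (agbb_treat a \<sigma>) n ?S) = set n \<union> treated ?S"
  proof (rule Cons.IH[OF S(1)])
    show "\<forall>\<beta>\<in>set n. \<beta> = 0 \<or> \<beta> \<in> plus_set (set (st_b ?S))"
      using Cons.prems(4) plus_set_mono[OF S(3)] by auto
  qed (use Cons.prems S(2) in auto)
  then show ?case using S(2) by simp
qed simp

lemma agbb_loop_invariant:
  assumes "agbb_loop a \<sigma> n S S'" and "state_invariant a \<sigma> S" and "distinct n"
    and "set n \<inter> treated S = {}"
    and "\<forall>\<alpha>\<in>set n. \<alpha> = 0 \<or> \<alpha> \<in> plus_set (set (st_b S))"
  shows "state_invariant a \<sigma> S' \<and> set n \<union> treated S \<subseteq> treated S'"
  using assms
proof (induction rule: agbb_loop.induct)
  case (step n S' S n' S'')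
  have S': "state_invariant a \<sigma> S'" "treated S' = set n \<union> treated S"
    using fold_agbb_treat_invariant[OF step.prems] step.hyps by auto
  have "state_invariant a \<sigma> S'' \<and> set n' \<union> treated S' \<subseteq> treated S''"
    using step.hyps S'
    by (intro step.IH) (auto simp: agbb_next_def border_def treated_def)
  then show ?case using S'(2) by blast
qed simp

lemma agbb_output_invariant:
  fixes \<sigma> :: "('n::finite, 'k::field) series"
  assumes "agbb_output a \<sigma> b c d p q"
  obtains t m where "agbb_invariant a \<sigma> b c d t p m q" and "0 \<in> set b \<or> 0 \<in> set d"
proof -
  obtain S where S: "agbb_loop a \<sigma> [0] (agbb_init a) S"
    "b = st_b S" "c = st_c S" "d = st_d S" "p = st_p S" "q = st_q S"
    using assms unfolding agbb_output_def by blast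
  have "state_invariant a \<sigma> S \<and> set [0] \<union> treated (agbb_init a :: ('n, 'k) agbb_state) \<subseteq> treated S"
    by (rule agbb_loop_invariant[OF S(1) state_invariant_init]) (auto simp: treated_def agbb_init_def)
  then show thesis
    using that S by (auto simp: state_invariant_def treated_def)
qed

section \<open>The output of the algorithm\<close>

theorem theorem3p5:
  fixes a b c d :: "('n::finite) expo list"
    and \<sigma> :: "('n, 'k::field) series"
    and p q :: "'n expo \<Rightarrow> ('n, 'k) mpol"
    and b' :: "'n expo set"
  assumes "distinct a" and "connected_to_0 (set a)"
    and "agbb_output a \<sigma> b c d p q"
    and "set d = border (set b)"
    and "connected_to_0 b'" and "plus_set (set c) \<subseteq> b'"
    and "{f * g | f g. f \<in> xpow ` plus_set (set b) \<and> g \<in> xpow ` b'}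
          = (xpow ` set a :: ('n, 'k) mpol set)"
  shows "\<exists>\<tau> :: ('n, 'k) series.
    (\<forall>f \<in> mpol.span (xpow ` set a). pairing \<tau> f = pairing \<sigma> f) \<and>
    has_rank (hankel \<tau>) (length b) \<and>
    basis_of_quot \<tau> (map p b) \<and> basis_of_quot \<tau> (map q b) \<and>
    (\<forall>i < length b. \<forall>j < length b.
       ip \<tau> (p (b ! i)) (q (b ! j)) = (if i = j then 1 else 0)) \<and>
    border_basis (set b) p (ann \<tau>) \<and>
    (\<forall>k. let M = mat (length b) (length b)
                    (\<lambda>(i, j). pairing \<sigma> (xpow (unit_expo k) * p (b ! j) * q (b ! i)))
         in mult_matrix \<tau> (map p b) (xpow (unit_expo k)) M \<and>
            mult_matrix \<tau> (map q b) (xpow (unit_expo k)) (transpose_mat M))"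
proof -
  obtain t m where inv: "agbb_invariant a \<sigma> b c d t p m q" and zero: "0 \<in> set b \<or> 0 \<in> set d"
    using agbb_output_invariant[OF assms(3)] by blast
  interpret A: agbb_invariant a \<sigma> b c d t p m q by (rule inv)
  \<comment> \<open>The exponent 0 is treated first; were it rejected, it would lie in \<open>d\<close>, hence in a border,
    but exponents in a border that are new to the set have positive degree.\<close>
  have zero_b: "0 \<in> set b"
    using zero zero_notin_border[of "set b"] assms(4) by auto
  have a_eq: "set a = {\<alpha> + \<gamma> | \<alpha> \<gamma>. \<alpha> \<in> plus_set (set b) \<and> \<gamma> \<in> b'}"
  proof -
    have "(xpow ` set a :: ('n, 'k) mpol set)
        = xpow ` {\<alpha> + \<gamma> | \<alpha> \<gamma>. \<alpha> \<in> plus_set (set b) \<and> \<gamma> \<in> b'}"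
      unfolding assms(7)[symmetric] by (rule xpow_products)
    then show ?thesis by (simp only: inj_image_eq_iff[OF inj_xpow])
  qed
  have p_in_W: "p \<alpha> \<in> mpol.span (xpow ` plus_set (set b))" if "\<alpha> \<in> border (set b)" for \<alpha>
  proof -
    have "p \<alpha> - xpow \<alpha> \<in> mpol.span (xpow ` plus_set (set b))"
      using A.d_monic[of \<alpha>] that assms(4)
        mpol.span_mono[OF image_mono[OF subset_plus_set[of "set b"], of xpow]] by auto
    moreover have "xpow \<alpha> \<in> mpol.span (xpow ` plus_set (set b))"
      using that by (auto simp: border_def intro: mpol.span_base)
    ultimately have "(p \<alpha> - xpow \<alpha>) + xpow \<alpha> \<in> mpol.span (xpow ` plus_set (set b))"
      by (rule mpol.span_add)
    then show ?thesis by simp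
  qed
  interpret F: flat_data \<sigma> "set b" "set c" b' p q
  proof
    show "connected_to_0 (set b)"
      using zero_b A.b_connected unfolding connected_to_0_def by blast
    fix \<beta> assume "\<beta> \<in> set b"
    then show "p \<beta> \<in> mpol.span (xpow ` set b)" "xpow \<beta> \<in> mpol.span (p ` set b)"
      "q \<beta> \<in> mpol.span (xpow ` set c)"
      using A.span_p A.span_m A.q_span by (auto intro: mpol.span_base)
  next
    fix \<alpha> \<gamma> assume \<alpha>: "\<alpha> \<in> border (set b)" and \<gamma>: "\<gamma> \<in> b'"
    have "mpol.span (xpow ` (+) \<gamma> ` plus_set (set b)) \<subseteq> (mpol.span (xpow ` set a) :: ('n, 'k) mpol set)"
      using \<gamma> unfolding a_eq by (intro mpol.span_mono image_mono) (auto simp: add.commute)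
    then have "xpow \<gamma> * p \<alpha> \<in> mpol.span (xpow ` set a)"
      using xpow_mult_span[OF p_in_W[OF \<alpha>]] by blast
    moreover have "\<gamma> \<in> set a"
      using \<gamma> zero_b subset_plus_set[of "set b"] unfolding a_eq by force
    ultimately show "ip \<sigma> (p \<alpha>) (xpow \<gamma>) = 0"
      using A.d_orth \<alpha> assms(4) by blast
  qed (use assms A.dual A.d_monic in auto)
  obtain \<phi> where "Vector_Spaces.linear pscale pscale \<phi>" "\<And>f. \<phi> f \<in> F.V" "\<phi> 1 = 1"
    "\<And>k f. \<phi> (xpow (unit_expo k) * f) = F.M k (\<phi> f)"
    by (rule F.normal_form_exists) blast
  then interpret N: flat_normal_form \<sigma> "set b" "set c" b' p q \<phi>
    by (intro flat_normal_form.intro F.flat_data_axioms flat_normal_form_axioms.intro)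
  \<comment> \<open>The extension that is trivial on the ideal of the border relations.\<close>
  define \<tau> where "\<tau> = N.\<tau>"
  have agree: "pairing \<tau> f = pairing \<sigma> f" if "f \<in> mpol.span (xpow ` set a)" for f
    using that
  proof (induction rule: mpol.span_induct_alt)
    case (step x f g)
    then obtain \<alpha> \<gamma> where \<alpha>\<gamma>: "\<alpha> \<in> plus_set (set b)" "\<gamma> \<in> b'" "f = xpow \<alpha> * xpow \<gamma>"
      by (auto simp: a_eq xpow_mult)
    have "pairing \<tau> f = pairing \<sigma> f"
      using N.\<tau>_agrees[of "xpow \<alpha>" \<gamma>] \<alpha>\<gamma> by (simp add: ip_def \<tau>_def mpol.span_base)
    then show ?case using step(2) by (simp add: pairing_add pairing_pscale)
  qed simp
  let ?us = "map p b" and ?vs = "map q b" and ?r = "length b"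
  have len: "length ?vs = length ?us" by simp
  have pV: "p \<beta> \<in> F.V" if "\<beta> \<in> set b" for \<beta>
    by (rule F.p_span[OF that])
  have ip_q: "ip \<tau> f (q \<beta>) = ip \<sigma> f (q \<beta>)" if "f \<in> F.W" "\<beta> \<in> set b" for f \<beta>
    unfolding \<tau>_def by (rule N.\<tau>_agrees_q[OF that])
  have dual: "ip \<tau> (?us ! i) (?vs ! j) = (if i = j then 1 else 0)"
    if "i < length ?us" "j < length ?us" for i j
    using that A.dual[of "b ! i" "b ! j"] ip_q[of "p (b ! i)" "b ! j"] pV[of "b ! i"] F.V_subset_W A.distinct_b
    by (auto simp: nth_eq_iff_index_eq)
  then have dual': "ip \<tau> (?vs ! i) (?us ! j) = (if i = j then 1 else 0)"
    if "i < length ?vs" "j < length ?vs" for i j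
    using that by (auto simp: ip_commute[of \<tau> "q _"])
  have in_ann: "f \<in> ann \<tau> \<longleftrightarrow> \<phi> f = 0" for f
    unfolding \<tau>_def by (rule N.in_ann_iff)
  have residue: "f - \<phi> f \<in> ann \<tau>" for f
    by (simp add: in_ann N.\<phi>_diff N.\<phi>_\<phi>)
  have span: "\<exists>u\<in>mpol.span (set ?us). f - u \<in> ann \<tau>" for f
    using residue[of f] N.\<phi>_in_V[of f] F.span_p by auto
  have left: "f - (\<Sum>i<length ?us. pscale (ip \<tau> f (?vs ! i)) (?us ! i)) \<in> ann \<tau>"
    and right: "f - (\<Sum>i<length ?us. pscale (ip \<tau> f (?us ! i)) (?vs ! i)) \<in> ann \<tau>" for f
    using dual_expansion_left[OF len _ span] dual_expansion_right[OF len _ span] dual by blast+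
  have span_q: "\<exists>u\<in>mpol.span (set ?vs). f - u \<in> ann \<tau>" for f
  proof
    show "f - (\<Sum>i<length ?us. pscale (ip \<tau> f (?us ! i)) (?vs ! i)) \<in> ann \<tau>"
      by (rule right)
    show "(\<Sum>i<length ?us. pscale (ip \<tau> f (?us ! i)) (?vs ! i)) \<in> mpol.span (set ?vs)"
      by (rule mpol.span_sum, rule mpol.span_scale, rule mpol.span_base) simp
  qed
  have border: "border_basis (set b) p (ann \<tau>)"
    unfolding border_basis_def
  proof (intro conjI ballI allI)
    fix \<alpha> assume "\<alpha> \<in> border (set b)"
    from F.border_monic[OF this] show "\<exists>g\<in>F.V. p \<alpha> = xpow \<alpha> + g"
      by (intro bexI[of _ "p \<alpha> - xpow \<alpha>"]) auto
  next
    interpret R: cring "poly_ring :: ('n, 'k) mpol ring" by (rule cring_poly_ring)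
    let ?J = "Idl\<^bsub>poly_ring\<^esub> (p ` border (set b))"
    have carrier: "p ` border (set b) \<subseteq> carrier poly_ring" by (simp add: poly_ring_def)
    interpret J: ideal ?J poly_ring by (rule R.genideal_ideal[OF carrier])
    have "p ` border (set b) \<subseteq> ann \<tau>"
      using p_in_W by (auto simp: in_ann N.\<phi>_W F.\<pi>_border)
    then have "?J \<subseteq> ann \<tau>"
      by (rule R.genideal_minimal[OF ideal_ann])
    moreover have "f \<in> ?J" if "f \<in> ann \<tau>" for f
    proof -
      have "f - \<phi> f \<in> ?J"
        using R.genideal_self[OF carrier] J.zero_closed J.a_closed J.I_l_closed
        by (intro N.diff_\<phi>_in_ideal) (simp_all add: poly_ring_def)
      then show ?thesis using that by (simp add: in_ann)
    qed
    ultimately show "ann \<tau> = ?J" by blast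
  next
    show "F.V \<inter> ann \<tau> = {0}"
      by (auto simp: in_ann N.\<phi>_fix N.\<phi>_0 mpol.span_zero)
  next
    fix h
    show "\<exists>u\<in>F.V. \<exists>v\<in>ann \<tau>. h = u + v"
      using N.\<phi>_in_V residue by (intro bexI[of _ "\<phi> h"] bexI[of _ "h - \<phi> h"]) auto
  qed
  have "mult_matrix \<tau> ?us (xpow (unit_expo k)) A \<and> mult_matrix \<tau> ?vs (xpow (unit_expo k)) (transpose_mat A)"
    if A: "A = mat ?r ?r (\<lambda>(i, j). pairing \<sigma> (xpow (unit_expo k) * p (b ! j) * q (b ! i)))" for k A
  proof -
    let ?x = "xpow (unit_expo k)"
    have entry: "A $$ (i, j) = ip \<tau> (?x * p (b ! j)) (q (b ! i))" if "i < ?r" "j < ?r" for i j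
      using that ip_q[OF F.unit_mult_in_W[OF pV]] by (simp add: A ip_def)
    have "mult_matrix \<tau> ?us ?x A"
    proof (rule mult_matrixI)
      fix j assume "j < length ?us"
      then show "?x * ?us ! j - (\<Sum>i<length ?us. pscale (A $$ (i, j)) (?us ! i)) \<in> ann \<tau>"
        using left[of "?x * ?us ! j"] by (simp add: entry)
    qed (simp add: A)
    moreover have "mult_matrix \<tau> ?vs ?x (transpose_mat A)"
    proof (rule mult_matrixI)
      fix j assume j: "j < length ?vs"
      have "transpose_mat A $$ (i, j) = ip \<tau> (?x * q (b ! j)) (p (b ! i))" if "i < ?r" for i
      proof -
        have "transpose_mat A $$ (i, j) = A $$ (j, i)"
          using that j by (simp add: A)
        then show ?thesis
          using that j by (simp add: entry ip_def mult_ac)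
      qed
      then show "?x * ?vs ! j - (\<Sum>i<length ?vs. pscale (transpose_mat A $$ (i, j)) (?vs ! i)) \<in> ann \<tau>"
        using right[of "?x * ?vs ! j"] j by simp
    qed (simp add: A)
    ultimately show ?thesis ..
  qed
  moreover have "has_rank (hankel \<tau>) ?r"
    using has_rank_hankelI[OF len _ span] dual by simp
  moreover have "basis_of_quot \<tau> ?us" "basis_of_quot \<tau> ?vs"
    using basis_of_quotI[OF len _ span] basis_of_quotI[OF len[symmetric] _ span_q] dual dual' by blast+
  ultimately show ?thesis
    using agree border dual by (intro exI[of _ \<tau>]) (simp add: Let_def)
qed

end
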